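(* Let $R$ be an arbitrary associative unitary ring, let $L:\mathrm{Mod}(R)\to \mathbb{R}_{\geq 0}\cup\{\infty\}$ be a length function, and let $$0\to N_{\phi\restriction_N}\to M_\phi\to (M/N)_{\bar\phi}\to 0$$ be a short exact sequence in $\mathrm{lFin}_L[X^{\pm1}]$, where $\bar\phi$ is the map induced by $\phi$ on $M/N$. Then $$\mathrm{ent}_L(\phi)=\mathrm{ent}_L(\phi\restriction_N)+\mathrm{ent}_L(\bar\phi).$$
   Context: $\mathrm{Mod}(R)$ is the category of right $R$-modules. A function $L:\mathrm{Mod}(R)\to \mathbb{R}_{\geq 0}\cup\{\infty\}$ is a length function if: $L(0)=0$ and $L(M)=L(M')$ whenever $M\cong M'$; $L(M)=L(M')+L(M'')$ for every short exact sequence $0\to M'\to M\to M''\to 0$ (additive); and $L(M)=\sup\{L(F): F \text{ a finitely generated submodule of } M\}$ for all $M$ (upper continuous). A module $N$ is $L$-finite if $L(N)<\infty$; $\mathrm{Fin}_L(M)$ is the set of $L$-finite submodules of $M$. A module is locally $L$-finite if all its finitely generated submodules are $L$-finite. $M_\phi$, with $M$ a right $R$-module and $\phi\in\mathrm{End}_R(M)$, denotes the right $R[X]$-module with underlying $R$-module $M$ on which $X$ acts as $\phi$. $R[X^{\pm1}]$ is the ring of Laurent polynomials, and $\mathrm{Mod}(R[X^{\pm1}])$ is identified with the full subcategory of $\mathrm{Mod}(R[X])$ of those $M_\phi$ with $\phi$ an automorphism. $\mathrm{lFin}_L[X^{\pm1}]$ is the full subcategory of $\mathrm{Mod}(R[X^{\pm1}])$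 consisting of the $M_\phi$ with $M$ locally $L$-finite as an $R$-module (so in the claim $\phi$, $\phi\restriction_N$ and $\bar\phi$ are all automorphisms). For $N\in\mathrm{Fin}_L(M)$ and $n\geq 1$ let $T_n(\phi,N)=\sum_{i=0}^{n-1}\phi^i(N)$ and $\mathrm{ent}_L(\phi,N)=\lim_{n\to\infty}L(T_n(\phi,N))/n$ (the limit exists and is finite). The algebraic $L$-entropy is $\mathrm{ent}_L(M_\phi)=\mathrm{ent}_L(\phi)=\sup\{\mathrm{ent}_L(\phi,N): N\in\mathrm{Fin}_L(M)\}$. *)

theory Defs
  imports "HOL-Algebra.Algebra" "HOL-Library.Extended_Nonnegative_Real"
begin

(* The module locale of HOL-Algebra has commutative scalars, so right modules are set up here.
   As there, the module record extends the ring record only in order to reuse its additive part;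
   the fields mult and one of a module carry no meaning. *)

record ('r, 'm) rmodule = "'m ring" +
  ract :: "['m, 'r] \<Rightarrow> 'm"  (infixl "\<star>\<index>" 70)

locale right_module = R?: ring R + M?: abelian_group M
  for R :: "('r, 'z) ring_scheme" (structure) and M :: "('r, 'm) rmodule" (structure) +
  assumes ract_closed: "\<lbrakk>x \<in> carrier M; r \<in> carrier R\<rbrakk> \<Longrightarrow> x \<star>\<^bsub>M\<^esub> r \<in> carrier M"
    and ract_l_distr: "\<lbrakk>x \<in> carrier M; y \<in> carrier M; r \<in> carrier R\<rbrakk>
      \<Longrightarrow> (x \<oplus>\<^bsub>M\<^esub> y) \<star>\<^bsub>M\<^esub> r = x \<star>\<^bsub>M\<^esub> r \<oplus>\<^bsub>M\<^esub> y \<star>\<^bsub>M\<^esub> r"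
    and ract_r_distr: "\<lbrakk>x \<in> carrier M; r \<in> carrier R; s \<in> carrier R\<rbrakk>
      \<Longrightarrow> x \<star>\<^bsub>M\<^esub> (r \<oplus>\<^bsub>R\<^esub> s) = x \<star>\<^bsub>M\<^esub> r \<oplus>\<^bsub>M\<^esub> x \<star>\<^bsub>M\<^esub> s"
    and ract_assoc: "\<lbrakk>x \<in> carrier M; r \<in> carrier R; s \<in> carrier R\<rbrakk>
      \<Longrightarrow> x \<star>\<^bsub>M\<^esub> (r \<otimes>\<^bsub>R\<^esub> s) = (x \<star>\<^bsub>M\<^esub> r) \<star>\<^bsub>M\<^esub> s"
    and ract_one: "x \<in> carrier M \<Longrightarrow> x \<star>\<^bsub>M\<^esub> \<one>\<^bsub>R\<^esub> = x"

definition rmod_hom ::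
  "('r, 'z) ring_scheme \<Rightarrow> ('r, 'm) rmodule \<Rightarrow> ('r, 'n) rmodule \<Rightarrow> ('m \<Rightarrow> 'n) set" where
  "rmod_hom R M N = {f \<in> hom (add_monoid M) (add_monoid N).
     \<forall>x\<in>carrier M. \<forall>r\<in>carrier R. f (x \<star>\<^bsub>M\<^esub> r) = f x \<star>\<^bsub>N\<^esub> r}"

definition rmod_iso ::
  "('r, 'z) ring_scheme \<Rightarrow> ('r, 'm) rmodule \<Rightarrow> ('r, 'n) rmodule \<Rightarrow> ('m \<Rightarrow> 'n) set" where
  "rmod_iso R M N = {f \<in> rmod_hom R M N. bij_betw f (carrier M) (carrier N)}"

definition rsubmodule :: "('r, 'z) ring_scheme \<Rightarrow> ('r, 'm) rmodule \<Rightarrow> 'm set \<Rightarrow> bool" where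
  "rsubmodule R M H \<longleftrightarrow>
     additive_subgroup H M \<and> (\<forall>x\<in>H. \<forall>r\<in>carrier R. x \<star>\<^bsub>M\<^esub> r \<in> H)"

abbreviation rmod_restrict :: "('r, 'm) rmodule \<Rightarrow> 'm set \<Rightarrow> ('r, 'm) rmodule" where
  "rmod_restrict M H \<equiv> M\<lparr>carrier := H\<rparr>"

definition rspan :: "('r, 'z) ring_scheme \<Rightarrow> ('r, 'm) rmodule \<Rightarrow> 'm set \<Rightarrow> 'm set" where
  "rspan R M S = \<Inter>{H. rsubmodule R M H \<and> S \<subseteq> H}"

definition fg_rsubmodule :: "('r, 'z) ring_scheme \<Rightarrow> ('r, 'm) rmodule \<Rightarrow> 'm set \<Rightarrow> bool" where
  "fg_rsubmodule R M F \<longleftrightarrow> (\<exists>S. finite S \<and> S \<subseteq> carrier M \<and> F = rspan R M S)"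

definition rmod_short_exact ::
  "('r, 'z) ring_scheme \<Rightarrow> ('r, 'k) rmodule \<Rightarrow> ('r, 'm) rmodule \<Rightarrow> ('r, 'n) rmodule
     \<Rightarrow> ('k \<Rightarrow> 'm) \<Rightarrow> ('m \<Rightarrow> 'n) \<Rightarrow> bool" where
  "rmod_short_exact R N M Q f g \<longleftrightarrow>
     f \<in> rmod_hom R N M \<and> g \<in> rmod_hom R M Q \<and>
     inj_on f (carrier N) \<and> f ` carrier N = a_kernel M Q g \<and> g ` carrier M = carrier Q"

(* Mod(R) is rendered as the collection of all right R-modules whose carrier is a subset of the
   arbitrary type 'm. Any quotient of such a module is again, up to isomorphism, such a module
   (choose a representative of each coset), and the restriction to 'm of a length function
   defined on a larger universe is a length function in the sense below. *)

locale length_function = ring R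
  for R :: "('r, 'z) ring_scheme" (structure) +
  fixes L :: "('r, 'm) rmodule \<Rightarrow> ennreal"
  assumes L_zero: "\<lbrakk>right_module R M; carrier M = {\<zero>\<^bsub>M\<^esub>}\<rbrakk> \<Longrightarrow> L M = 0"
    and L_iso: "\<lbrakk>right_module R M; right_module R M'; rmod_iso R M M' \<noteq> {}\<rbrakk> \<Longrightarrow> L M = L M'"
    and L_additive: "\<lbrakk>right_module R M'; right_module R M; right_module R M'';
      rmod_short_exact R M' M M'' f g\<rbrakk> \<Longrightarrow> L M = L M' + L M''"
    and L_upper_continuous: "right_module R M \<Longrightarrow>
      L M = (SUP F\<in>{F. fg_rsubmodule R M F}. L (rmod_restrict M F))"

definition Fin_L ::
  "('r, 'z) ring_scheme \<Rightarrow> (('r, 'm) rmodule \<Rightarrow> ennreal) \<Rightarrow> ('r, 'm) rmodule \<Rightarrow> 'm set set" where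
  "Fin_L R L M = {K. rsubmodule R M K \<and> L (rmod_restrict M K) < \<infinity>}"

definition locally_L_finite ::
  "('r, 'z) ring_scheme \<Rightarrow> (('r, 'm) rmodule \<Rightarrow> ennreal) \<Rightarrow> ('r, 'm) rmodule \<Rightarrow> bool" where
  "locally_L_finite R L M \<longleftrightarrow> (\<forall>F. fg_rsubmodule R M F \<longrightarrow> L (rmod_restrict M F) < \<infinity>)"

(* Objects and morphisms of lFin_L[X, X^-1]: a module over the Laurent polynomial ring is a pair
   (M, phi) with phi an automorphism of the R-module M, and linearity over that ring is
   R-linearity together with compatibility with the automorphisms. *)

definition lFin_Laurent ::
  "('r, 'z) ring_scheme \<Rightarrow> (('r, 'm) rmodule \<Rightarrow> ennreal) \<Rightarrow> ('r, 'm) rmodule \<Rightarrow> ('m \<Rightarrow> 'm) \<Rightarrow> bool"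
where
  "lFin_Laurent R L M \<phi> \<longleftrightarrow>
     right_module R M \<and> \<phi> \<in> rmod_iso R M M \<and> locally_L_finite R L M"

definition Laurent_hom ::
  "('r, 'z) ring_scheme \<Rightarrow> ('r, 'm) rmodule \<Rightarrow> ('m \<Rightarrow> 'm) \<Rightarrow> ('r, 'n) rmodule \<Rightarrow> ('n \<Rightarrow> 'n)
     \<Rightarrow> ('m \<Rightarrow> 'n) set" where
  "Laurent_hom R M \<phi> N \<psi> = {f \<in> rmod_hom R M N. \<forall>x\<in>carrier M. f (\<phi> x) = \<psi> (f x)}"

(* The sum of a family of submodules is the submodule generated by their union. *)

definition trajectory ::
  "('r, 'z) ring_scheme \<Rightarrow> ('r, 'm) rmodule \<Rightarrow> ('m \<Rightarrow> 'm) \<Rightarrow> 'm set \<Rightarrow> nat \<Rightarrow> 'm set" where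
  "trajectory R M \<phi> K n = rspan R M (\<Union>i<n. (\<phi> ^^ i) ` K)"

definition ent_at ::
  "('r, 'z) ring_scheme \<Rightarrow> (('r, 'm) rmodule \<Rightarrow> ennreal) \<Rightarrow> ('r, 'm) rmodule \<Rightarrow> ('m \<Rightarrow> 'm)
     \<Rightarrow> 'm set \<Rightarrow> ennreal" where
  "ent_at R L M \<phi> K = lim (\<lambda>n. L (rmod_restrict M (trajectory R M \<phi> K n)) / of_nat n)"

definition ent ::
  "('r, 'z) ring_scheme \<Rightarrow> (('r, 'm) rmodule \<Rightarrow> ennreal) \<Rightarrow> ('r, 'm) rmodule \<Rightarrow> ('m \<Rightarrow> 'm)
     \<Rightarrow> ennreal" where
  "ent R L M \<phi> = (SUP K\<in>Fin_L R L M. ent_at R L M \<phi> K)"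

end

theory Submission
  imports Defs
begin

text \<open>
  Write \<open>T K\<close> for the union of the trajectories \<open>T n K\<close> of \<open>K\<close>. Since \<open>T (n + 1) K = K + \<phi> (T n K)\<close>
  and \<open>\<phi>\<close> is injective, the length of \<open>T n K\<close> grows in the \<open>n\<close>-th step by the length of \<open>K\<close> modulo
  \<open>\<phi> (T n K)\<close>. By upper continuity these increments, and hence their means, converge to the length of
  \<open>K\<close> modulo \<open>\<phi> (T K)\<close>, which is therefore the entropy of \<open>\<phi>\<close> at \<open>K\<close>.

  For the upper bound put \<open>C = \<phi> (T F)\<close>. The length of \<open>F\<close> modulo \<open>C\<close> splits into the length of
  \<open>\<pi> F\<close> modulo \<open>\<pi> C\<close>, which is the entropy at \<open>\<pi> F\<close>, and the length of \<open>F \<inter> (C + N)\<close> modulo \<open>C\<close>.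
  The latter is at most the length of \<open>T F \<inter> N\<close> modulo \<open>C\<close>, which is approximated by finitely generated
  \<open>G \<subseteq> T F \<inter> N\<close>; as \<open>\<phi> (T G) \<subseteq> C\<close>, the length of \<open>G\<close> modulo \<open>C\<close> is at most the entropy at \<open>G\<close>.
  For the lower bound, entropies over the quotient are approximated by finitely generated submodules,
  which lift to \<open>M\<close>, and the lengths of trajectories are compared termwise.
\<close>

section \<open>Submodules and quotients of right modules\<close>

lemma right_module_ract_zero:
  assumes "right_module R M" and x: "x \<in> carrier M"
  shows "x \<star>\<^bsub>M\<^esub> \<zero>\<^bsub>R\<^esub> = \<zero>\<^bsub>M\<^esub>"
proof -
  interpret right_module R M by fact
  have c: "x \<star>\<^bsub>M\<^esub> \<zero>\<^bsub>R\<^esub> \<in> carrier M"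
    using x by (simp add: ract_closed)
  have "x \<star>\<^bsub>M\<^esub> \<zero>\<^bsub>R\<^esub> \<oplus>\<^bsub>M\<^esub> x \<star>\<^bsub>M\<^esub> \<zero>\<^bsub>R\<^esub> = x \<star>\<^bsub>M\<^esub> \<zero>\<^bsub>R\<^esub>"
    using ract_r_distr[OF x, of "\<zero>\<^bsub>R\<^esub>" "\<zero>\<^bsub>R\<^esub>"] by simp
  then show ?thesis
    using c M.add.r_cancel_one by blast
qed

lemma right_module_ract_minus_one:
  assumes "right_module R M" and x: "x \<in> carrier M"
  shows "x \<star>\<^bsub>M\<^esub> (\<ominus>\<^bsub>R\<^esub> \<one>\<^bsub>R\<^esub>) = \<ominus>\<^bsub>M\<^esub> x"
proof -
  interpret right_module R M by fact
  have c: "x \<star>\<^bsub>M\<^esub> (\<ominus>\<^bsub>R\<^esub> \<one>\<^bsub>R\<^esub>) \<in> carrier M"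
    using x by (simp add: ract_closed)
  have "x \<star>\<^bsub>M\<^esub> (\<ominus>\<^bsub>R\<^esub> \<one>\<^bsub>R\<^esub>) \<oplus>\<^bsub>M\<^esub> x = x \<star>\<^bsub>M\<^esub> (\<ominus>\<^bsub>R\<^esub> \<one>\<^bsub>R\<^esub> \<oplus>\<^bsub>R\<^esub> \<one>\<^bsub>R\<^esub>)"
    using ract_r_distr[OF x, of "\<ominus>\<^bsub>R\<^esub> \<one>\<^bsub>R\<^esub>" "\<one>\<^bsub>R\<^esub>"] x by (simp add: ract_one)
  also have "\<dots> = \<zero>\<^bsub>M\<^esub>"
    using right_module_ract_zero[OF assms] by (simp add: R.l_neg)
  finally show ?thesis
    using c x M.minus_equality by metis
qed

text \<open>Negatives come from the action: \<open>\<ominus> x\<close> is \<open>x\<close> acted on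
  by \<open>\<ominus> \<one>\<close>, so closure under sums and scalars already yields an additive
  subgroup.\<close>

lemma rsubmodule_iff:
  assumes "right_module R M"
  shows "rsubmodule R M H \<longleftrightarrow> H \<subseteq> carrier M \<and> \<zero>\<^bsub>M\<^esub> \<in> H \<and>
    (\<forall>x\<in>H. \<forall>y\<in>H. x \<oplus>\<^bsub>M\<^esub> y \<in> H) \<and> (\<forall>x\<in>H. \<forall>r\<in>carrier R. x \<star>\<^bsub>M\<^esub> r \<in> H)"
    (is "?L \<longleftrightarrow> ?P")
proof
  interpret right_module R M by fact
  show ?P if ?L
  proof -
    have act: "\<forall>x\<in>H. \<forall>r\<in>carrier R. x \<star>\<^bsub>M\<^esub> r \<in> H" and "additive_subgroup H M"
      using that by (auto simp: rsubmodule_def)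
    interpret additive_subgroup H M by fact
    show ?thesis using act a_subset zero_closed a_closed by blast
  qed
  assume P: ?P
  have "\<ominus>\<^bsub>M\<^esub> x \<in> H" if "x \<in> H" for x
    using right_module_ract_minus_one[OF assms, of x] P that
    by (metis R.a_inv_closed R.one_closed subsetD)
  then have "additive_subgroup H M"
    using P by unfold_locales (auto simp: a_inv_def)
  then show ?L
    using P by (simp add: rsubmodule_def)
qed

lemma rsubmoduleD:
  assumes "right_module R M" "rsubmodule R M H"
  shows rsubmodule_subset: "H \<subseteq> carrier M"
    and rsubmodule_zero: "\<zero>\<^bsub>M\<^esub> \<in> H"
    and rsubmodule_add: "\<And>x y. x \<in> H \<Longrightarrow> y \<in> H \<Longrightarrow> x \<oplus>\<^bsub>M\<^esub> y \<in> H"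
    and rsubmodule_ract: "\<And>x r. x \<in> H \<Longrightarrow> r \<in> carrier R \<Longrightarrow> x \<star>\<^bsub>M\<^esub> r \<in> H"
  using assms(2) unfolding rsubmodule_iff[OF assms(1)] by blast+

lemma rsubmodule_neg:
  assumes "right_module R M" "rsubmodule R M H" "x \<in> H"
  shows "\<ominus>\<^bsub>M\<^esub> x \<in> H"
proof -
  interpret right_module R M by fact
  have "x \<star>\<^bsub>M\<^esub> (\<ominus>\<^bsub>R\<^esub> \<one>\<^bsub>R\<^esub>) \<in> H"
    using rsubmodule_ract[OF assms] by simp
  then show ?thesis
    using right_module_ract_minus_one[OF assms(1)] rsubmodule_subset[OF assms(1,2)] assms(3) by auto
qed

lemma rsubmoduleI:
  assumes "right_module R M" "H \<subseteq> carrier M" "\<zero>\<^bsub>M\<^esub> \<in> H"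
    "\<And>x y. x \<in> H \<Longrightarrow> y \<in> H \<Longrightarrow> x \<oplus>\<^bsub>M\<^esub> y \<in> H"
    "\<And>x r. x \<in> H \<Longrightarrow> r \<in> carrier R \<Longrightarrow> x \<star>\<^bsub>M\<^esub> r \<in> H"
  shows "rsubmodule R M H"
  using assms by (simp add: rsubmodule_iff)

text \<open>The axioms pass along a surjection that respects the operations. Nothing is presupposed
  about \<open>Y\<close> as a group, and this is how the quotient built on chosen representatives
  becomes a module.\<close>

lemma right_module_image:
  fixes M :: "('r, 'm) rmodule" and Y :: "('r, 'n) rmodule"
  assumes "right_module R M" and surj: "carrier Y = q ` carrier M"
    and q_zero: "q \<zero>\<^bsub>M\<^esub> = \<zero>\<^bsub>Y\<^esub>"
    and q_add: "\<And>x y. x \<in> carrier M \<Longrightarrow> y \<in> carrier M \<Longrightarrow> q (x \<oplus>\<^bsub>M\<^esub> y) = q x \<oplus>\<^bsub>Y\<^esub> q y"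
    and q_act: "\<And>x r. x \<in> carrier M \<Longrightarrow> r \<in> carrier R \<Longrightarrow> q (x \<star>\<^bsub>M\<^esub> r) = q x \<star>\<^bsub>Y\<^esub> r"
  shows "right_module R Y"
proof -
  interpret right_module R M by fact
  have "abelian_group Y"
  proof (rule abelian_groupI, goal_cases)
    case (6 x)
    then obtain a where a: "a \<in> carrier M" "x = q a" by (auto simp: surj)
    then have "q (\<ominus>\<^bsub>M\<^esub> a) \<oplus>\<^bsub>Y\<^esub> x = q (\<ominus>\<^bsub>M\<^esub> a \<oplus>\<^bsub>M\<^esub> a)"
      using q_add[of "\<ominus>\<^bsub>M\<^esub> a" a] by simp
    also have "\<dots> = \<zero>\<^bsub>Y\<^esub>"
      using a(1) by (simp add: M.l_neg q_zero)
    finally have "q (\<ominus>\<^bsub>M\<^esub> a) \<oplus>\<^bsub>Y\<^esub> x = \<zero>\<^bsub>Y\<^esub>" .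
    then show ?case using a by (auto simp: surj)
  qed (auto simp: surj q_add[symmetric] q_zero[symmetric] M.a_ac)
  then show ?thesis
    unfolding right_module_def right_module_axioms_def
    using R.ring_axioms
    by (auto simp: surj q_add[symmetric] q_act[symmetric] ract_closed ract_l_distr ract_r_distr
        ract_assoc ract_one)
qed

lemma right_module_restrict:
  assumes "right_module R M" "rsubmodule R M H"
  shows "right_module R (rmod_restrict M H)"
proof -
  interpret right_module R M by fact
  note H = rsubmoduleD[OF assms]
  have "abelian_group (rmod_restrict M H)"
  proof (rule abelian_groupI, goal_cases)
    case (6 x)
    then show ?case
      using rsubmodule_neg[OF assms, of x] H(1) M.l_neg by auto
  qed (use H in \<open>auto simp: subset_iff M.a_ac\<close>)
  then show ?thesis
    unfolding right_module_def right_module_axioms_def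
    using R.ring_axioms H
    by (auto simp: subset_iff ract_closed ract_l_distr ract_r_distr ract_assoc ract_one)
qed

lemma rsubmodule_restrict_iff:
  assumes "right_module R M" "rsubmodule R M K"
  shows "rsubmodule R (rmod_restrict M K) H \<longleftrightarrow> rsubmodule R M H \<and> H \<subseteq> K"
  using rsubmodule_subset[OF assms]
  unfolding rsubmodule_iff[OF assms(1)] rsubmodule_iff[OF right_module_restrict[OF assms]]
  by simp blast

lemma rsubmodule_carrier: "right_module R M \<Longrightarrow> rsubmodule R M (carrier M)"
proof -
  assume "right_module R M"
  then interpret right_module R M .
  show "rsubmodule R M (carrier M)"
    by (rule rsubmoduleI) (auto simp: ract_closed right_module_axioms)
qed

lemma rsubmodule_Int:
  assumes "right_module R M" "rsubmodule R M A" "rsubmodule R M B"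
  shows "rsubmodule R M (A \<inter> B)"
  using assms(2,3) unfolding rsubmodule_iff[OF assms(1)] by blast

lemma rsubmodule_zero_set:
  assumes "right_module R M"
  shows "rsubmodule R M {\<zero>\<^bsub>M\<^esub>}"
proof -
  interpret right_module R M by fact
  have "\<zero>\<^bsub>M\<^esub> \<star>\<^bsub>M\<^esub> r = \<zero>\<^bsub>M\<^esub>" if r: "r \<in> carrier R" for r
  proof -
    have "\<zero>\<^bsub>M\<^esub> \<star>\<^bsub>M\<^esub> r \<oplus>\<^bsub>M\<^esub> \<zero>\<^bsub>M\<^esub> \<star>\<^bsub>M\<^esub> r = \<zero>\<^bsub>M\<^esub> \<star>\<^bsub>M\<^esub> r"
      using ract_l_distr[of "\<zero>\<^bsub>M\<^esub>" "\<zero>\<^bsub>M\<^esub>" r] r by simp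
    then show ?thesis
      using r M.add.r_cancel_one ract_closed[of "\<zero>\<^bsub>M\<^esub>" r] by blast
  qed
  then show ?thesis
    using assms by (simp add: rsubmodule_iff)
qed

lemma rsubmodule_sum:
  assumes "right_module R M" and A: "rsubmodule R M A" and B: "rsubmodule R M B"
  shows "rsubmodule R M (A <+>\<^bsub>M\<^esub> B)"
proof -
  interpret right_module R M by fact
  note a = rsubmoduleD[OF assms(1) A] and b = rsubmoduleD[OF assms(1) B]
  show ?thesis
  proof (rule rsubmoduleI[OF assms(1)])
    show "A <+>\<^bsub>M\<^esub> B \<subseteq> carrier M" using a(1) b(1) by (auto simp: set_add_def' subset_iff)
    show "\<zero>\<^bsub>M\<^esub> \<in> A <+>\<^bsub>M\<^esub> B" using a(2) b(2) by (force simp: set_add_def')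
  next
    fix x y assume "x \<in> A <+>\<^bsub>M\<^esub> B" "y \<in> A <+>\<^bsub>M\<^esub> B"
    then obtain u v u' v' where *: "u \<in> A" "v \<in> B" "u' \<in> A" "v' \<in> B"
      "x = u \<oplus>\<^bsub>M\<^esub> v" "y = u' \<oplus>\<^bsub>M\<^esub> v'" by (auto simp: set_add_def')
    have "x \<oplus>\<^bsub>M\<^esub> y = (u \<oplus>\<^bsub>M\<^esub> u') \<oplus>\<^bsub>M\<^esub> (v \<oplus>\<^bsub>M\<^esub> v')"
      using * a(1) b(1) by (simp add: subset_iff M.a_ac)
    then show "x \<oplus>\<^bsub>M\<^esub> y \<in> A <+>\<^bsub>M\<^esub> B"
      unfolding set_add_def' using a(3)[OF *(1,3)] b(3)[OF *(2,4)] by blast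
  next
    fix x r assume "x \<in> A <+>\<^bsub>M\<^esub> B" and r: "r \<in> carrier R"
    then obtain u v where *: "u \<in> A" "v \<in> B" "x = u \<oplus>\<^bsub>M\<^esub> v" by (auto simp: set_add_def')
    then have "x \<star>\<^bsub>M\<^esub> r = u \<star>\<^bsub>M\<^esub> r \<oplus>\<^bsub>M\<^esub> v \<star>\<^bsub>M\<^esub> r"
      using ract_l_distr[of u v r] r a(1) b(1) by auto
    then show "x \<star>\<^bsub>M\<^esub> r \<in> A <+>\<^bsub>M\<^esub> B"
      unfolding set_add_def' using a(4)[OF *(1) r] b(4)[OF *(2) r] by blast
  qed
qed

lemma subset_set_add:
  assumes "right_module R M" "rsubmodule R M A" "rsubmodule R M B"
  shows "A \<subseteq> A <+>\<^bsub>M\<^esub> B" "B \<subseteq> A <+>\<^bsub>M\<^esub> B"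
proof -
  interpret right_module R M by fact
  note a = rsubmoduleD[OF assms(1,2)] and b = rsubmoduleD[OF assms(1,3)]
  show "A \<subseteq> A <+>\<^bsub>M\<^esub> B"
  proof
    fix x assume "x \<in> A"
    moreover have "x = x \<oplus>\<^bsub>M\<^esub> \<zero>\<^bsub>M\<^esub>" using a(1) \<open>x \<in> A\<close> by auto
    ultimately show "x \<in> A <+>\<^bsub>M\<^esub> B" using b(2) unfolding set_add_def' by blast
  qed
  show "B \<subseteq> A <+>\<^bsub>M\<^esub> B"
  proof
    fix x assume "x \<in> B"
    moreover have "x = \<zero>\<^bsub>M\<^esub> \<oplus>\<^bsub>M\<^esub> x" using b(1) \<open>x \<in> B\<close> by auto
    ultimately show "x \<in> A <+>\<^bsub>M\<^esub> B" using a(2) unfolding set_add_def' by blast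
  qed
qed

section \<open>Generated submodules and increasing unions\<close>

lemma rspan_subset: "S \<subseteq> rspan R M S"
  by (auto simp: rspan_def)

lemma rspan_least: "\<lbrakk>rsubmodule R M H; S \<subseteq> H\<rbrakk> \<Longrightarrow> rspan R M S \<subseteq> H"
  by (auto simp: rspan_def)

lemma rsubmodule_rspan:
  assumes "right_module R M" "S \<subseteq> carrier M"
  shows "rsubmodule R M (rspan R M S)"
proof (rule rsubmoduleI[OF assms(1)])
  show "rspan R M S \<subseteq> carrier M"
    using assms by (intro rspan_least rsubmodule_carrier)
qed (auto simp: rspan_def dest: rsubmoduleD[OF assms(1)])

text \<open>Upper continuity for a submodule speaks of spans formed inside that submodule; this
  identifies them with spans in the ambient module.\<close>

lemma rspan_restrict:
  assumes "right_module R M" "rsubmodule R M K" "S \<subseteq> K"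
  shows "rspan R (rmod_restrict M K) S = rspan R M S"
proof
  have S: "S \<subseteq> carrier M" using assms rsubmoduleD(1) by blast
  show "rspan R (rmod_restrict M K) S \<subseteq> rspan R M S"
    by (intro rspan_least)
      (auto simp: rsubmodule_restrict_iff assms rsubmodule_rspan S rspan_subset
        intro: subsetD[OF rspan_least[OF assms(2,3)]])
  have "rsubmodule R (rmod_restrict M K) (rspan R (rmod_restrict M K) S)"
    using assms by (intro rsubmodule_rspan right_module_restrict) auto
  then show "rspan R M S \<subseteq> rspan R (rmod_restrict M K) S"
    by (intro rspan_least) (auto simp: rsubmodule_restrict_iff assms rspan_subset)
qed

lemma rsubmodule_UN_chain:
  fixes C :: "nat \<Rightarrow> 'm set"
  assumes "right_module R M" "\<And>n. rsubmodule R M (C n)" "incseq C"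
  shows "rsubmodule R M (\<Union>n. C n)"
proof (rule rsubmoduleI[OF assms(1)])
  fix x y assume "x \<in> (\<Union>n. C n)" "y \<in> (\<Union>n. C n)"
  then obtain i j where "x \<in> C i" "y \<in> C j" by auto
  then have "x \<in> C (max i j)" "y \<in> C (max i j)"
    using incseqD[OF assms(3), of i "max i j"] incseqD[OF assms(3), of j "max i j"] by auto
  then show "x \<oplus>\<^bsub>M\<^esub> y \<in> (\<Union>n. C n)"
    using rsubmodule_add[OF assms(1,2)] by blast
qed (use rsubmoduleD[OF assms(1,2)] in \<open>auto simp: subset_iff, blast\<close>)

section \<open>Homomorphisms, images and preimages\<close>

lemma rmod_homD:
  assumes "f \<in> rmod_hom R M N"
  shows rmod_hom_closed: "\<And>x. x \<in> carrier M \<Longrightarrow> f x \<in> carrier N"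
    and rmod_hom_add: "\<And>x y. x \<in> carrier M \<Longrightarrow> y \<in> carrier M \<Longrightarrow> f (x \<oplus>\<^bsub>M\<^esub> y) = f x \<oplus>\<^bsub>N\<^esub> f y"
    and rmod_hom_ract: "\<And>x r. x \<in> carrier M \<Longrightarrow> r \<in> carrier R \<Longrightarrow> f (x \<star>\<^bsub>M\<^esub> r) = f x \<star>\<^bsub>N\<^esub> r"
  using assms by (auto simp: rmod_hom_def hom_def)

lemma rmod_homI:
  assumes "\<And>x. x \<in> carrier M \<Longrightarrow> f x \<in> carrier N"
    and "\<And>x y. x \<in> carrier M \<Longrightarrow> y \<in> carrier M \<Longrightarrow> f (x \<oplus>\<^bsub>M\<^esub> y) = f x \<oplus>\<^bsub>N\<^esub> f y"
    and "\<And>x r. x \<in> carrier M \<Longrightarrow> r \<in> carrier R \<Longrightarrow> f (x \<star>\<^bsub>M\<^esub> r) = f x \<star>\<^bsub>N\<^esub> r"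
  shows "f \<in> rmod_hom R M N"
  using assms by (auto simp: rmod_hom_def hom_def)

lemma rmod_hom_zero:
  assumes M: "right_module R M" and N: "right_module R N" and f: "f \<in> rmod_hom R M N"
  shows "f \<zero>\<^bsub>M\<^esub> = \<zero>\<^bsub>N\<^esub>"
proof -
  interpret right_module R M by fact
  have "f \<zero>\<^bsub>M\<^esub> = f (\<zero>\<^bsub>M\<^esub> \<star>\<^bsub>M\<^esub> \<zero>\<^bsub>R\<^esub>)"
    by (simp add: right_module_ract_zero[OF M])
  also have "\<dots> = f \<zero>\<^bsub>M\<^esub> \<star>\<^bsub>N\<^esub> \<zero>\<^bsub>R\<^esub>"
    by (simp add: rmod_hom_ract[OF f])
  finally show ?thesis
    by (simp add: right_module_ract_zero[OF N] rmod_hom_closed[OF f])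
qed

lemma rmod_hom_neg:
  assumes M: "right_module R M" and N: "right_module R N" and f: "f \<in> rmod_hom R M N"
    and x: "x \<in> carrier M"
  shows "f (\<ominus>\<^bsub>M\<^esub> x) = \<ominus>\<^bsub>N\<^esub> f x"
proof -
  interpret right_module R M by fact
  show ?thesis
    using rmod_hom_ract[OF f x, of "\<ominus>\<^bsub>R\<^esub> \<one>\<^bsub>R\<^esub>"] x
    by (simp add: right_module_ract_minus_one[OF M] right_module_ract_minus_one[OF N]
        rmod_hom_closed[OF f])
qed

lemma rsubmodule_image:
  assumes M: "right_module R M" and N: "right_module R N" and f: "f \<in> rmod_hom R M N"
    and A: "rsubmodule R M A"
  shows "rsubmodule R N (f ` A)"
proof (rule rsubmoduleI[OF N])
  note a = rsubmoduleD[OF M A] and h = rmod_homD[OF f]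
  show "f ` A \<subseteq> carrier N" using a(1) h(1) by auto
  show "\<zero>\<^bsub>N\<^esub> \<in> f ` A" using a(2) rmod_hom_zero[OF M N f] by force
  show "x \<oplus>\<^bsub>N\<^esub> y \<in> f ` A" if "x \<in> f ` A" "y \<in> f ` A" for x y
    using that a(1) a(3) by (auto simp: h(2)[symmetric] subset_iff)
  show "x \<star>\<^bsub>N\<^esub> r \<in> f ` A" if "x \<in> f ` A" "r \<in> carrier R" for x r
    using that a(1) a(4) by (auto simp: h(3)[symmetric] subset_iff)
qed

lemma rsubmodule_preimage:
  assumes M: "right_module R M" and N: "right_module R N" and f: "f \<in> rmod_hom R M N"
    and A: "rsubmodule R M A" and B: "rsubmodule R N B"
  shows "rsubmodule R M {x \<in> A. f x \<in> B}"
proof (rule rsubmoduleI[OF M])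
  note a = rsubmoduleD[OF M A] and b = rsubmoduleD[OF N B] and h = rmod_homD[OF f]
  show "{x \<in> A. f x \<in> B} \<subseteq> carrier M" using a(1) by auto
  show "\<zero>\<^bsub>M\<^esub> \<in> {x \<in> A. f x \<in> B}" using a(2) b(2) rmod_hom_zero[OF M N f] by simp
  show "x \<oplus>\<^bsub>M\<^esub> y \<in> {x \<in> A. f x \<in> B}" if "x \<in> {x \<in> A. f x \<in> B}" "y \<in> {x \<in> A. f x \<in> B}" for x y
    using that a(1) a(3) b(3) h(2) by (auto simp: subset_iff)
  show "x \<star>\<^bsub>M\<^esub> r \<in> {x \<in> A. f x \<in> B}" if "x \<in> {x \<in> A. f x \<in> B}" "r \<in> carrier R" for x r
    using that a(1) a(4) b(4) h(3) by (auto simp: subset_iff)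
qed

text \<open>Each inclusion is minimality of a span: the preimage of the right side is a submodule
  containing \<open>S\<close>, and the left side is a submodule containing the image of
  \<open>S\<close>.\<close>

lemma image_rspan:
  assumes M: "right_module R M" and N: "right_module R N" and f: "f \<in> rmod_hom R M N"
    and S: "S \<subseteq> carrier M"
  shows "f ` rspan R M S = rspan R N (f ` S)"
proof
  have fS: "f ` S \<subseteq> carrier N" using S rmod_hom_closed[OF f] by blast
  have "rsubmodule R M {x \<in> carrier M. f x \<in> rspan R N (f ` S)}"
    by (rule rsubmodule_preimage[OF M N f rsubmodule_carrier[OF M] rsubmodule_rspan[OF N fS]])
  moreover have "S \<subseteq> {x \<in> carrier M. f x \<in> rspan R N (f ` S)}"
  proof
    fix x assume "x \<in> S"
    then show "x \<in> {x \<in> carrier M. f x \<in> rspan R N (f ` S)}"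
      using S subsetD[OF rspan_subset imageI] by auto
  qed
  ultimately have "rspan R M S \<subseteq> {x \<in> carrier M. f x \<in> rspan R N (f ` S)}"
    by (rule rspan_least)
  then show "f ` rspan R M S \<subseteq> rspan R N (f ` S)" by (auto simp: image_subset_iff)
  show "rspan R N (f ` S) \<subseteq> f ` rspan R M S"
    by (rule rspan_least[OF rsubmodule_image[OF M N f rsubmodule_rspan[OF M S]]])
      (intro image_mono rspan_subset)
qed

text \<open>A coset is encoded by a chosen representative, so that the quotient again lives on the type
  \<open>'m\<close>, where the length function is defined.\<close>

definition coset_rep :: "('r, 'm) rmodule \<Rightarrow> 'm set \<Rightarrow> 'm \<Rightarrow> 'm" where
  "coset_rep M C x = (SOME y. y \<in> (\<lambda>c. x \<oplus>\<^bsub>M\<^esub> c) ` C)"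

text \<open>Results are normalised by \<open>coset_rep\<close> again, because a sum or multiple of
  chosen representatives need not be a chosen one; likewise the zero is the element chosen from
  \<open>C\<close>.\<close>

definition rquotient :: "('r, 'm) rmodule \<Rightarrow> 'm set \<Rightarrow> ('r, 'm) rmodule" where
  "rquotient M C = M\<lparr>carrier := coset_rep M C ` carrier M, zero := coset_rep M C \<zero>\<^bsub>M\<^esub>,
     add := \<lambda>x y. coset_rep M C (x \<oplus>\<^bsub>M\<^esub> y), ract := \<lambda>x r. coset_rep M C (x \<star>\<^bsub>M\<^esub> r)\<rparr>"

lemma coset_rep_mem:
  assumes "right_module R M" "rsubmodule R M C"
  obtains c where "c \<in> C" "coset_rep M C x = x \<oplus>\<^bsub>M\<^esub> c"
proof -
  have "coset_rep M C x \<in> (\<lambda>c. x \<oplus>\<^bsub>M\<^esub> c) ` C"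
    unfolding coset_rep_def
    by (rule someI[of _ "x \<oplus>\<^bsub>M\<^esub> \<zero>\<^bsub>M\<^esub>"]) (rule imageI[OF rsubmodule_zero[OF assms]])
  then show ?thesis
    by (rule imageE) (rule that)
qed

text \<open>The cosets of \<open>x \<oplus> c\<close> and of \<open>x\<close> are the same set, so
  the choice operator picks the same element.\<close>

lemma coset_rep_add:
  assumes "right_module R M" "rsubmodule R M C" "x \<in> carrier M" "c \<in> C"
  shows "coset_rep M C (x \<oplus>\<^bsub>M\<^esub> c) = coset_rep M C x"
proof -
  interpret right_module R M by fact
  note C = rsubmoduleD[OF assms(1,2)] and n = rsubmodule_neg[OF assms(1,2)]
  have "(\<lambda>d. x \<oplus>\<^bsub>M\<^esub> c \<oplus>\<^bsub>M\<^esub> d) ` C = (\<lambda>d. x \<oplus>\<^bsub>M\<^esub> d) ` C"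
  proof (intro equalityI subsetI)
    fix y assume "y \<in> (\<lambda>d. x \<oplus>\<^bsub>M\<^esub> c \<oplus>\<^bsub>M\<^esub> d) ` C"
    then obtain d where d: "d \<in> C" "y = x \<oplus>\<^bsub>M\<^esub> c \<oplus>\<^bsub>M\<^esub> d" by auto
    then have "y = x \<oplus>\<^bsub>M\<^esub> (c \<oplus>\<^bsub>M\<^esub> d)" using assms(3,4) C(1) by (simp add: subset_iff M.a_assoc)
    then show "y \<in> (\<lambda>d. x \<oplus>\<^bsub>M\<^esub> d) ` C" using d C(3)[OF assms(4)] by auto
  next
    fix y assume "y \<in> (\<lambda>d. x \<oplus>\<^bsub>M\<^esub> d) ` C"
    then obtain d where d: "d \<in> C" "y = x \<oplus>\<^bsub>M\<^esub> d" by auto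
    have "c \<in> carrier M" "d \<in> carrier M" using d assms(4) C(1) by auto
    then have "y = x \<oplus>\<^bsub>M\<^esub> c \<oplus>\<^bsub>M\<^esub> (\<ominus>\<^bsub>M\<^esub> c \<oplus>\<^bsub>M\<^esub> d)"
      using assms(3) d(2) M.r_neg2[of c d] by (simp add: M.a_assoc)
    then show "y \<in> (\<lambda>d. x \<oplus>\<^bsub>M\<^esub> c \<oplus>\<^bsub>M\<^esub> d) ` C" using d C(3) n[OF assms(4)] by auto
  qed
  then show ?thesis by (simp add: coset_rep_def)
qed

lemma coset_rep_hom:
  assumes M: "right_module R M" and C: "rsubmodule R M C"
  shows right_module_rquotient: "right_module R (rquotient M C)"
    and coset_rep_in_hom: "coset_rep M C \<in> rmod_hom R M (rquotient M C)"
    and coset_rep_zero_iff: "\<And>x. x \<in> carrier M \<Longrightarrow> coset_rep M C x = \<zero>\<^bsub>rquotient M C\<^esub> \<longleftrightarrow> x \<in> C"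
proof -
  interpret right_module R M by fact
  note c = rsubmoduleD[OF M C]
  have cM: "a \<in> carrier M" if "a \<in> C" for a using that c(1) by auto
  \<comment> \<open>Replacing \<open>x\<close> and \<open>y\<close> by their representatives changes
    the sum by an element of \<open>C\<close>, which \<open>coset_rep\<close> does not see.\<close>
  have rep_add: "coset_rep M C (x \<oplus>\<^bsub>M\<^esub> y) = coset_rep M C (coset_rep M C x \<oplus>\<^bsub>M\<^esub> coset_rep M C y)"
    if "x \<in> carrier M" "y \<in> carrier M" for x y
  proof -
    obtain a where a: "a \<in> C" "coset_rep M C x = x \<oplus>\<^bsub>M\<^esub> a" by (rule coset_rep_mem[OF M C])
    obtain b where b: "b \<in> C" "coset_rep M C y = y \<oplus>\<^bsub>M\<^esub> b" by (rule coset_rep_mem[OF M C])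
    have "coset_rep M C x \<oplus>\<^bsub>M\<^esub> coset_rep M C y = (x \<oplus>\<^bsub>M\<^esub> y) \<oplus>\<^bsub>M\<^esub> (a \<oplus>\<^bsub>M\<^esub> b)"
      using that a b by (simp add: cM M.a_ac)
    then show ?thesis using that a b c(3) by (simp add: coset_rep_add[OF M C])
  qed
  have rep_act: "coset_rep M C (x \<star>\<^bsub>M\<^esub> r) = coset_rep M C (coset_rep M C x \<star>\<^bsub>M\<^esub> r)"
    if "x \<in> carrier M" "r \<in> carrier R" for x r
  proof -
    obtain a where a: "a \<in> C" "coset_rep M C x = x \<oplus>\<^bsub>M\<^esub> a" by (rule coset_rep_mem[OF M C])
    then have "coset_rep M C x \<star>\<^bsub>M\<^esub> r = x \<star>\<^bsub>M\<^esub> r \<oplus>\<^bsub>M\<^esub> a \<star>\<^bsub>M\<^esub> r"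
      using that by (simp add: cM ract_l_distr)
    then show ?thesis using that a c(4) by (simp add: coset_rep_add[OF M C] ract_closed)
  qed
  show "right_module R (rquotient M C)"
    by (rule right_module_image[OF M, where q = "coset_rep M C"])
      (auto simp: rquotient_def rep_add[symmetric] rep_act[symmetric])
  show "coset_rep M C \<in> rmod_hom R M (rquotient M C)"
    by (rule rmod_homI) (auto simp: rquotient_def rep_add[symmetric] rep_act[symmetric])
  fix x assume x: "x \<in> carrier M"
  obtain a where a: "a \<in> C" "coset_rep M C x = x \<oplus>\<^bsub>M\<^esub> a" by (rule coset_rep_mem[OF M C])
  obtain b where b: "b \<in> C" "coset_rep M C \<zero>\<^bsub>M\<^esub> = \<zero>\<^bsub>M\<^esub> \<oplus>\<^bsub>M\<^esub> b" by (rule coset_rep_mem[OF M C])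
  show "coset_rep M C x = \<zero>\<^bsub>rquotient M C\<^esub> \<longleftrightarrow> x \<in> C"
  proof
    assume "coset_rep M C x = \<zero>\<^bsub>rquotient M C\<^esub>"
    then have "b = x \<oplus>\<^bsub>M\<^esub> a" using a b cM by (simp add: rquotient_def)
    then have "x = b \<oplus>\<^bsub>M\<^esub> \<ominus>\<^bsub>M\<^esub> a"
      using x cM[OF a(1)] by (simp add: M.a_assoc M.r_neg)
    then show "x \<in> C" using a(1) b(1) c(3) rsubmodule_neg[OF M C] by simp
  next
    assume "x \<in> C"
    then show "coset_rep M C x = \<zero>\<^bsub>rquotient M C\<^esub>"
      using coset_rep_add[OF M C, of "\<zero>\<^bsub>M\<^esub>" x] x by (simp add: rquotient_def)
  qed
qed

section \<open>Length modulo a submodule\<close>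

text \<open>This allows the image of \<open>A\<close> alone to stand for \<open>(A + C) / C\<close>,
  although \<open>A\<close> need not contain \<open>C\<close>.\<close>

lemma coset_rep_image_set_add:
  assumes M: "right_module R M" and A: "rsubmodule R M A" and C: "rsubmodule R M C"
  shows "coset_rep M C ` (A <+>\<^bsub>M\<^esub> C) = coset_rep M C ` A"
proof
  show "coset_rep M C ` (A <+>\<^bsub>M\<^esub> C) \<subseteq> coset_rep M C ` A"
    using rsubmodule_subset[OF M A] coset_rep_add[OF M C]
    by (fastforce simp: set_add_def' image_iff)
  show "coset_rep M C ` A \<subseteq> coset_rep M C ` (A <+>\<^bsub>M\<^esub> C)"
    by (intro image_mono subset_set_add(1)[OF M A C])
qed

text \<open>The length of \<open>(A + C) / C\<close>; unlike a difference of lengths it makes sense when \<open>C\<close> has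
  infinite length.\<close>

definition relative_length ::
  "(('r, 'm) rmodule \<Rightarrow> ennreal) \<Rightarrow> ('r, 'm) rmodule \<Rightarrow> 'm set \<Rightarrow> 'm set \<Rightarrow> ennreal" where
  "relative_length L M A C = L (rmod_restrict (rquotient M C) (coset_rep M C ` A))"

section \<open>Additivity, monotonicity and continuity of length\<close>

context length_function
begin

text \<open>Additivity on the sequence from the kernel of \<open>f\<close> on \<open>A\<close>
  through \<open>A\<close> to its image. The splittings modulo a submodule and along
  \<open>\<pi>\<close> are instances.\<close>

lemma L_image:
  assumes M: "right_module R M" and Q: "right_module R Q" and f: "f \<in> rmod_hom R M Q"
    and A: "rsubmodule R M A"
  shows "L (rmod_restrict M A) =
    L (rmod_restrict M {x \<in> A. f x = \<zero>\<^bsub>Q\<^esub>}) + L (rmod_restrict Q (f ` A))"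
proof -
  let ?K = "{x \<in> A. f x = \<zero>\<^bsub>Q\<^esub>}"
  have K: "rsubmodule R M ?K"
    using rsubmodule_preimage[OF M Q f A rsubmodule_zero_set[OF Q]] by simp
  have AM: "A \<subseteq> carrier M" by (rule rsubmodule_subset[OF M A])
  have "(\<lambda>x. x) \<in> rmod_hom R (rmod_restrict M ?K) (rmod_restrict M A)"
    by (rule rmod_homI) auto
  moreover have "f \<in> rmod_hom R (rmod_restrict M A) (rmod_restrict Q (f ` A))"
    using AM by (intro rmod_homI) (auto simp: rmod_hom_add[OF f] rmod_hom_ract[OF f] subset_iff)
  ultimately have "rmod_short_exact R (rmod_restrict M ?K) (rmod_restrict M A)
      (rmod_restrict Q (f ` A)) (\<lambda>x. x) f"
    by (auto simp: rmod_short_exact_def a_kernel_def')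
  then show ?thesis
    using M Q K A f
    by (intro L_additive[where f = "\<lambda>x. x" and g = f]) (auto intro: right_module_restrict rsubmodule_image)
qed

lemma L_inj_image:
  assumes M: "right_module R M" and Q: "right_module R Q" and f: "f \<in> rmod_hom R M Q"
    and inj: "inj_on f (carrier M)" and A: "rsubmodule R M A"
  shows "L (rmod_restrict Q (f ` A)) = L (rmod_restrict M A)"
proof -
  note z = rmod_hom_zero[OF M Q f] and Z = rsubmodule_zero_set[OF M]
  have "{x \<in> A. f x = \<zero>\<^bsub>Q\<^esub>} = {\<zero>\<^bsub>M\<^esub>}"
    using rsubmodule_subset[OF M A] rsubmodule_zero[OF M A] rsubmodule_zero[OF M Z]
      rsubmodule_subset[OF M Z] inj z
    by (auto simp: z[symmetric] inj_on_eq_iff subset_iff)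
  moreover have "L (rmod_restrict M {\<zero>\<^bsub>M\<^esub>}) = 0"
    by (rule L_zero) (auto intro: right_module_restrict M Z)
  ultimately show ?thesis
    using L_image[OF M Q f A] by simp
qed

lemma L_split:
  assumes M: "right_module R M" and A: "rsubmodule R M A" and C: "rsubmodule R M C"
  shows "L (rmod_restrict M A) = L (rmod_restrict M (A \<inter> C)) + relative_length L M A C"
proof -
  have "{x \<in> A. coset_rep M C x = \<zero>\<^bsub>rquotient M C\<^esub>} = A \<inter> C"
    using coset_rep_zero_iff[OF M C] rsubmodule_subset[OF M A] by blast
  then show ?thesis
    using L_image[OF M right_module_rquotient[OF M C] coset_rep_in_hom[OF M C] A]
    by (simp add: relative_length_def)
qed

lemma L_mono:
  assumes M: "right_module R M" and A: "rsubmodule R M A" and B: "rsubmodule R M B" and "A \<subseteq> B"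
  shows "L (rmod_restrict M A) \<le> L (rmod_restrict M B)"
  using L_split[OF M B A] \<open>A \<subseteq> B\<close> by (simp add: inf_absorb2)

text \<open>This is \<open>L_split\<close> for the sum, which meets \<open>C\<close> in
  \<open>C\<close> and has the same image modulo \<open>C\<close> as \<open>A\<close>.\<close>

lemma L_set_add:
  assumes M: "right_module R M" and A: "rsubmodule R M A" and C: "rsubmodule R M C"
  shows "L (rmod_restrict M (A <+>\<^bsub>M\<^esub> C)) = L (rmod_restrict M C) + relative_length L M A C"
proof -
  have "(A <+>\<^bsub>M\<^esub> C) \<inter> C = C"
    using subset_set_add(2)[OF M A C] by blast
  then show ?thesis
    using L_split[OF M rsubmodule_sum[OF M A C] C]
    by (simp add: relative_length_def coset_rep_image_set_add[OF M A C])
qed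

lemma relative_length_le:
  assumes M: "right_module R M" and A: "rsubmodule R M A" and C: "rsubmodule R M C"
  shows "relative_length L M A C \<le> L (rmod_restrict M A)"
  by (simp add: L_split[OF assms])

text \<open>The inclusion is required only between the images in the quotient, because in the upper
  bound it is available only modulo \<open>C\<close>.\<close>

lemma relative_length_mono:
  assumes M: "right_module R M" and A: "rsubmodule R M A" and B: "rsubmodule R M B"
    and C: "rsubmodule R M C" and sub: "coset_rep M C ` A \<subseteq> coset_rep M C ` B"
  shows "relative_length L M A C \<le> relative_length L M B C"
  unfolding relative_length_def
  by (intro L_mono right_module_rquotient rsubmodule_image[OF M] coset_rep_in_hom M A B C sub)

text \<open>Splitting \<open>A\<close> along \<open>C\<close> and along \<open>D\<close> gives the
  same total; the part inside the submodule grows from \<open>C\<close> to \<open>D\<close>, so the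
  part modulo it shrinks. Finiteness permits the cancellation.\<close>

lemma relative_length_antimono:
  assumes M: "right_module R M" and A: "rsubmodule R M A" and C: "rsubmodule R M C"
    and D: "rsubmodule R M D" and "C \<subseteq> D" and fin: "L (rmod_restrict M A) < \<infinity>"
  shows "relative_length L M A D \<le> relative_length L M A C"
proof -
  have le: "L (rmod_restrict M (A \<inter> C)) \<le> L (rmod_restrict M (A \<inter> D))"
    using \<open>C \<subseteq> D\<close> by (intro L_mono rsubmodule_Int M A C D) auto
  have "L (rmod_restrict M (A \<inter> D)) < \<infinity>"
    using fin L_split[OF M A D] by (auto simp: less_top[symmetric])
  moreover have "L (rmod_restrict M (A \<inter> D)) + relative_length L M A D
      \<le> L (rmod_restrict M (A \<inter> D)) + relative_length L M A C"
    using add_right_mono[OF le, of "relative_length L M A C"] L_split[OF M A C] L_split[OF M A D]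
    by simp
  ultimately show ?thesis
    by (auto simp: ennreal_add_left_cancel_le)
qed

text \<open>By upper continuity it suffices to bound the finitely generated submodules of the image,
  and each is the image of the span of finitely many elements of \<open>A\<close>. With
  \<open>f\<close> the identity this bounds the length of \<open>A\<close>, with
  \<open>coset_rep\<close> a relative length.\<close>

lemma L_image_le:
  assumes M: "right_module R M" and Q: "right_module R Q" and f: "f \<in> rmod_hom R M Q"
    and A: "rsubmodule R M A"
    and bound: "\<And>S. finite S \<Longrightarrow> S \<subseteq> A \<Longrightarrow> L (rmod_restrict Q (f ` rspan R M S)) \<le> b"
  shows "L (rmod_restrict Q (f ` A)) \<le> b"
proof -
  note fA = rsubmodule_image[OF M Q f A]
  have "L (rmod_restrict (rmod_restrict Q (f ` A)) F) \<le> b"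
    if F: "fg_rsubmodule R (rmod_restrict Q (f ` A)) F" for F
  proof -
    obtain S' where "finite S'" "S' \<subseteq> carrier (rmod_restrict Q (f ` A))"
        "F = rspan R (rmod_restrict Q (f ` A)) S'"
      using F unfolding fg_rsubmodule_def by blast
    then have S': "finite S'" "S' \<subseteq> f ` A" "F = rspan R (rmod_restrict Q (f ` A)) S'"
      by simp_all
    obtain S where S: "finite S" "S \<subseteq> A" "S' = f ` S"
      using finite_subset_image[OF S'(1,2)] by metis
    have SM: "S \<subseteq> carrier M" using S(2) rsubmodule_subset[OF M A] by (rule subset_trans)
    have "F = f ` rspan R M S"
      using rspan_restrict[OF Q fA S'(2)] image_rspan[OF M Q f SM] S'(3) S(3) by simp
    then show ?thesis using bound[OF S(1,2)] by simp
  qed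
  then show ?thesis
    by (subst L_upper_continuous[OF right_module_restrict[OF Q fA]]) (rule SUP_least, simp only: mem_Collect_eq)
qed

text \<open>A finite subset of an increasing union lies in one member, so every finitely generated
  submodule of the union is bounded by a term of the supremum.\<close>

lemma L_UN_chain:
  fixes C :: "nat \<Rightarrow> 'm set"
  assumes M: "right_module R M" and C: "\<And>n. rsubmodule R M (C n)" and inc: "incseq C"
  shows "L (rmod_restrict M (\<Union>n. C n)) = (SUP n. L (rmod_restrict M (C n)))"
proof (rule antisym)
  note U = rsubmodule_UN_chain[OF M C inc]
  show "(SUP n. L (rmod_restrict M (C n))) \<le> L (rmod_restrict M (\<Union>n. C n))"
    by (intro SUP_least L_mono M C U) auto
  have hom: "(\<lambda>x. x) \<in> rmod_hom R M M"
    by (rule rmod_homI) auto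
  have "L (rmod_restrict M (rspan R M S)) \<le> (SUP n. L (rmod_restrict M (C n)))"
    if S: "finite S" "S \<subseteq> (\<Union>n. C n)" for S
  proof -
    have "\<exists>n. S \<subseteq> C n"
      using S
    proof (induction S)
      case (insert x S)
      then obtain m n where "x \<in> C m" "S \<subseteq> C n" by auto
      then have "insert x S \<subseteq> C (max m n)"
        using incseqD[OF inc, of m "max m n"] incseqD[OF inc, of n "max m n"] by auto
      then show ?case by blast
    qed simp
    then obtain n where n: "S \<subseteq> C n" by blast
    have "S \<subseteq> carrier M" using n rsubmodule_subset[OF M C] by (rule subset_trans)
    then have "L (rmod_restrict M (rspan R M S)) \<le> L (rmod_restrict M (C n))"
      by (intro L_mono M C rspan_least n rsubmodule_rspan)
    then show ?thesis by (rule SUP_upper2[OF UNIV_I])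
  qed
  then show "L (rmod_restrict M (\<Union>n. C n)) \<le> (SUP n. L (rmod_restrict M (C n)))"
    using L_image_le[OF M M hom U] by simp
qed

end

section \<open>Trajectories\<close>

text \<open>For a submodule \<open>K\<close> and an endomorphism \<open>\<phi>\<close> this is the
  smallest \<open>\<phi>\<close>-stable submodule containing \<open>K\<close>, in other words the
  R[X]-submodule generated by \<open>K\<close>. Writing it as an increasing union suits the
  continuity of length.\<close>

definition full_trajectory ::
  "('r, 'z) ring_scheme \<Rightarrow> ('r, 'm) rmodule \<Rightarrow> ('m \<Rightarrow> 'm) \<Rightarrow> 'm set \<Rightarrow> 'm set" where
  "full_trajectory R M \<phi> K = (\<Union>n. trajectory R M \<phi> K n)"

lemma funpow_closed:
  "\<lbrakk>\<phi> \<in> rmod_hom R M M; x \<in> carrier M\<rbrakk> \<Longrightarrow> (\<phi> ^^ i) x \<in> carrier M"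
  by (induction i) (simp_all add: rmod_hom_closed)

lemma orbit_subset_carrier:
  assumes "right_module R M" "\<phi> \<in> rmod_hom R M M" "K \<subseteq> carrier M"
  shows "(\<Union>i<n. (\<phi> ^^ i) ` K) \<subseteq> carrier M"
  using funpow_closed[OF assms(2)] assms(3) by fast

lemma rsubmodule_trajectory:
  assumes "right_module R M" "\<phi> \<in> rmod_hom R M M" "K \<subseteq> carrier M"
  shows "rsubmodule R M (trajectory R M \<phi> K n)"
  unfolding trajectory_def by (intro rsubmodule_rspan orbit_subset_carrier[OF assms] assms)

lemma rspan_mono:
  assumes "right_module R M" "S \<subseteq> S'" "S' \<subseteq> carrier M"
  shows "rspan R M S \<subseteq> rspan R M S'"
  using assms rspan_subset[of S' R M] by (intro rspan_least rsubmodule_rspan) auto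

lemma incseq_trajectory:
  assumes "right_module R M" "\<phi> \<in> rmod_hom R M M" "K \<subseteq> carrier M"
  shows "incseq (trajectory R M \<phi> K)"
  unfolding trajectory_def
  by (intro monoI rspan_mono[OF assms(1)] orbit_subset_carrier[OF assms]) force

lemma rsubmodule_full_trajectory:
  assumes "right_module R M" "\<phi> \<in> rmod_hom R M M" "K \<subseteq> carrier M"
  shows "rsubmodule R M (full_trajectory R M \<phi> K)"
  unfolding full_trajectory_def
  by (intro rsubmodule_UN_chain rsubmodule_trajectory[OF assms] incseq_trajectory[OF assms] assms)

text \<open>Iterating the intertwining relation turns \<open>\<phi> ^^ i\<close> into
  \<open>\<chi> ^^ i\<close>, and images commute with spans.\<close>

lemma image_trajectory:
  assumes M: "right_module R M" and Q: "right_module R Q"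
    and \<phi>: "\<phi> \<in> rmod_hom R M M"
    and f: "f \<in> Laurent_hom R M \<phi> Q \<chi>" and K: "K \<subseteq> carrier M"
  shows "f ` trajectory R M \<phi> K n = trajectory R Q \<chi> (f ` K) n"
proof -
  have fh: "f \<in> rmod_hom R M Q" and fc: "\<And>x. x \<in> carrier M \<Longrightarrow> f (\<phi> x) = \<chi> (f x)"
    using f by (auto simp: Laurent_hom_def)
  have *: "f ((\<phi> ^^ i) x) = (\<chi> ^^ i) (f x)" if "x \<in> carrier M" for x i
    by (induction i) (simp_all add: fc funpow_closed[OF \<phi> that])
  have "f ` (\<Union>i<n. (\<phi> ^^ i) ` K) = (\<Union>i<n. (\<chi> ^^ i) ` f ` K)"
    unfolding image_UN image_image using * K by (intro SUP_cong image_cong) auto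
  then show ?thesis
    unfolding trajectory_def
    using image_rspan[OF M Q fh orbit_subset_carrier[OF M \<phi> K]] by simp
qed

lemma trajectory_least:
  assumes "rsubmodule R M H" "\<phi> ` H \<subseteq> H" "K \<subseteq> H"
  shows "trajectory R M \<phi> K n \<subseteq> H"
proof -
  have "(\<phi> ^^ i) x \<in> H" if "x \<in> K" for x i
    using that assms(2,3) by (induction i) auto
  then show ?thesis
    unfolding trajectory_def by (intro rspan_least assms) auto
qed

text \<open>Every orbit term of positive index is \<open>\<phi>\<close> applied to its predecessor.
  Adding \<open>K\<close> in front, rather than a new iterate at the end, keeps the measured module
  fixed while only the submodule divided out grows.\<close>

lemma trajectory_Suc:
  assumes M: "right_module R M" and \<phi>: "\<phi> \<in> rmod_hom R M M" and K: "rsubmodule R M K"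
  shows "trajectory R M \<phi> K (Suc n) = K <+>\<^bsub>M\<^esub> \<phi> ` trajectory R M \<phi> K n"
proof
  note KM = rsubmodule_subset[OF M K]
  note T = rsubmodule_trajectory[OF M \<phi> KM]
  note \<phi>T = rsubmodule_image[OF M M \<phi> T]
  show "trajectory R M \<phi> K (Suc n) \<subseteq> K <+>\<^bsub>M\<^esub> \<phi> ` trajectory R M \<phi> K n"
  proof -
    have "(\<phi> ^^ i) ` K \<subseteq> K <+>\<^bsub>M\<^esub> \<phi> ` trajectory R M \<phi> K n" if "i < Suc n" for i
    proof (cases i)
      case 0
      then show ?thesis using subset_set_add(1)[OF M K \<phi>T] by simp
    next
      case (Suc j)
      have "(\<phi> ^^ j) ` K \<subseteq> trajectory R M \<phi> K n"
        using that Suc rspan_subset[of "\<Union>i<n. (\<phi> ^^ i) ` K" R M] by (auto simp: trajectory_def)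
      then have "(\<phi> ^^ i) ` K \<subseteq> \<phi> ` trajectory R M \<phi> K n"
        by (auto simp: Suc)
      then show ?thesis using subset_set_add(2)[OF M K \<phi>T] by (rule subset_trans)
    qed
    then show ?thesis
      unfolding trajectory_def[of R M \<phi> K "Suc n"]
      by (intro rspan_least rsubmodule_sum M K \<phi>T UN_least) simp
  qed
  have KT: "K \<subseteq> trajectory R M \<phi> K (Suc n)"
    using rspan_subset[of "\<Union>i<Suc n. (\<phi> ^^ i) ` K" R M] unfolding trajectory_def by fastforce
  have "\<phi> ` trajectory R M \<phi> K n = rspan R M (\<phi> ` (\<Union>i<n. (\<phi> ^^ i) ` K))"
    unfolding trajectory_def by (rule image_rspan[OF M M \<phi> orbit_subset_carrier[OF M \<phi> KM]])
  also have "\<dots> \<subseteq> trajectory R M \<phi> K (Suc n)"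
  proof (rule rspan_least[OF T])
    have "\<phi> ` (\<Union>i<n. (\<phi> ^^ i) ` K) = (\<Union>i<n. (\<phi> ^^ Suc i) ` K)"
      by (simp add: image_UN image_image)
    also have "\<dots> \<subseteq> (\<Union>i<Suc n. (\<phi> ^^ i) ` K)" by blast
    also have "\<dots> \<subseteq> trajectory R M \<phi> K (Suc n)"
      unfolding trajectory_def by (rule rspan_subset)
    finally show "\<phi> ` (\<Union>i<n. (\<phi> ^^ i) ` K) \<subseteq> trajectory R M \<phi> K (Suc n)" .
  qed
  finally have \<phi>T': "\<phi> ` trajectory R M \<phi> K n \<subseteq> trajectory R M \<phi> K (Suc n)" .
  show "K <+>\<^bsub>M\<^esub> \<phi> ` trajectory R M \<phi> K n \<subseteq> trajectory R M \<phi> K (Suc n)"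
    using KT \<phi>T' rsubmodule_add[OF M T] unfolding set_add_def' by blast
qed

lemma image_full_trajectory_subset:
  assumes M: "right_module R M" and \<phi>: "\<phi> \<in> rmod_hom R M M" and K: "rsubmodule R M K"
  shows "\<phi> ` full_trajectory R M \<phi> K \<subseteq> full_trajectory R M \<phi> K"
proof -
  note KM = rsubmodule_subset[OF M K]
  have "\<phi> ` trajectory R M \<phi> K n \<subseteq> trajectory R M \<phi> K (Suc n)" for n
    unfolding trajectory_Suc[OF assms]
    by (intro subset_set_add(2)[OF M K] rsubmodule_image[OF M M \<phi>] rsubmodule_trajectory[OF M \<phi> KM])
  then show ?thesis unfolding full_trajectory_def by blast
qed

lemma subset_full_trajectory: "K \<subseteq> full_trajectory R M \<phi> K"
proof -
  have "K \<subseteq> (\<Union>i<1. (\<phi> ^^ i) ` K)" by (simp add: lessThan_Suc)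
  also have "\<dots> \<subseteq> trajectory R M \<phi> K 1"
    unfolding trajectory_def by (rule rspan_subset)
  finally show ?thesis by (auto simp: full_trajectory_def)
qed

section \<open>Convergence of means and conversion to reals\<close>

text \<open>The deviations from the limit are split at \<open>N\<close>: the later ones are below
  \<open>e / 2\<close> each, and the sum \<open>B\<close> of the earlier ones becomes negligible
  after division by \<open>n\<close>.\<close>

lemma Cesaro_mean_tendsto:
  fixes c :: "nat \<Rightarrow> real"
  assumes "c \<longlonglongrightarrow> l"
  shows "(\<lambda>n. (\<Sum>i<n. c i) / real n) \<longlonglongrightarrow> l"
proof (rule LIMSEQ_I)
  fix e :: real assume "0 < e"
  then obtain N where N: "\<And>i. i \<ge> N \<Longrightarrow> \<bar>c i - l\<bar> < e / 2"
    using LIMSEQ_D[OF assms, of "e / 2"] by auto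
  define B where "B = (\<Sum>i<N. \<bar>c i - l\<bar>)"
  \<comment> \<open>Chosen so that \<open>B < n * (e / 2)\<close> for all
    \<open>n \<ge> n0\<close>.\<close>
  obtain n0 :: nat where n0: "2 * B / e < real n0" using reals_Archimedean2 by blast
  have "norm ((\<Sum>i<n. c i) / real n - l) < e" if n: "n \<ge> max (max N n0) 1" for n
  proof -
    have "\<bar>(\<Sum>i<n. c i) - real n * l\<bar> = \<bar>\<Sum>i<n. c i - l\<bar>"
      by (simp add: sum_subtractf)
    also have "\<dots> \<le> (\<Sum>i<n. \<bar>c i - l\<bar>)" by (rule sum_abs)
    also have "\<dots> = B + (\<Sum>i=N..<n. \<bar>c i - l\<bar>)"
      using n sum.atLeastLessThan_concat[of 0 N n "\<lambda>i. \<bar>c i - l\<bar>"]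
      by (simp add: B_def lessThan_atLeast0)
    also have "(\<Sum>i=N..<n. \<bar>c i - l\<bar>) \<le> (\<Sum>i=N..<n. e / 2)"
      using N by (intro sum_mono) (simp add: less_imp_le)
    also have "\<dots> \<le> real n * (e / 2)"
      using \<open>0 < e\<close> by (simp add: mult_right_mono)
    finally have "\<bar>(\<Sum>i<n. c i) - real n * l\<bar> \<le> B + real n * (e / 2)" by simp
    moreover have "B < real n * (e / 2)"
    proof -
      have "2 * B / e < real n" using n0 n by linarith
      then show ?thesis using \<open>0 < e\<close> by (simp add: field_simps)
    qed
    ultimately have "\<bar>(\<Sum>i<n. c i) - real n * l\<bar> < real n * e" by simp
    moreover have "(\<Sum>i<n. c i) / real n - l = ((\<Sum>i<n. c i) - real n * l) / real n"
      using n by (simp add: field_simps)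
    ultimately show ?thesis
      using n by (simp add: field_simps)
  qed
  then show "\<exists>no. \<forall>n\<ge>no. norm ((\<Sum>i<n. c i) / real n - l) < e" by blast
qed

lemma enn2real_add:
  assumes "x < \<infinity>" "y < \<infinity>"
  shows "enn2real (x + y) = enn2real x + enn2real y"
  using assms by (cases x; cases y) (auto simp: ennreal_plus[symmetric] simp del: ennreal_plus)

lemma kernel_eq_image:
  assumes "rmod_short_exact R N M Q \<iota> \<pi>"
  shows "{x \<in> carrier M. \<pi> x = \<zero>\<^bsub>Q\<^esub>} = \<iota> ` carrier N"
  using assms by (simp add: rmod_short_exact_def a_kernel_def')

section \<open>Entropy at a submodule as a relative length\<close>

context length_function
begin

text \<open>\<open>F\<close> modulo \<open>C\<close> maps onto its image modulo the image of
  \<open>C\<close>; the kernel consists of the classes of those elements of \<open>F\<close> that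
  lie in \<open>C\<close> plus the kernel of \<open>\<pi>\<close>. Lengths are compared before
  dividing by \<open>C\<close>, and the finite length of \<open>F \<inter> C\<close> is cancelled at
  the end.\<close>

lemma relative_length_exact:
  assumes M: "right_module R M" and Q: "right_module R Q" and \<pi>: "\<pi> \<in> rmod_hom R M Q"
    and F: "rsubmodule R M F" and C: "rsubmodule R M C"
    and fin: "L (rmod_restrict M F) < \<infinity>"
  shows "relative_length L M F C =
    relative_length L M (F \<inter> (C <+>\<^bsub>M\<^esub> {x \<in> carrier M. \<pi> x = \<zero>\<^bsub>Q\<^esub>})) C +
    relative_length L Q (\<pi> ` F) (\<pi> ` C)"
proof -
  let ?N = "{x \<in> carrier M. \<pi> x = \<zero>\<^bsub>Q\<^esub>}"
  let ?H = "F \<inter> (C <+>\<^bsub>M\<^esub> ?N)"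
  interpret right_module R M by fact
  note FM = rsubmodule_subset[OF M F] and CM = rsubmodule_subset[OF M C]
  have N: "rsubmodule R M ?N"
    using rsubmodule_preimage[OF M Q \<pi> rsubmodule_carrier[OF M] rsubmodule_zero_set[OF Q]] by simp
  have H: "rsubmodule R M ?H"
    by (intro rsubmodule_Int rsubmodule_sum M F C N)
  have "\<pi> ` ?H = \<pi> ` F \<inter> \<pi> ` C"
  proof (intro equalityI subsetI)
    fix y assume "y \<in> \<pi> ` ?H"
    then obtain h c n where h: "y = \<pi> h" "h \<in> F" "h = c \<oplus>\<^bsub>M\<^esub> n" "c \<in> C" "n \<in> ?N"
      unfolding set_add_def' by blast
    have "y = \<pi> c \<oplus>\<^bsub>Q\<^esub> \<zero>\<^bsub>Q\<^esub>"
      using h CM rmod_hom_add[OF \<pi>, of c n] by auto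
    also have "\<dots> = \<pi> c"
      using h CM rmod_hom_closed[OF \<pi>]
      by (metis Q abelian_group.axioms(1) abelian_monoid.r_zero right_module.axioms(2) subsetD)
    finally show "y \<in> \<pi> ` F \<inter> \<pi> ` C"
      using h by blast
  next
    fix y assume "y \<in> \<pi> ` F \<inter> \<pi> ` C"
    then obtain f c where fc: "f \<in> F" "c \<in> C" "y = \<pi> f" "\<pi> f = \<pi> c" by fastforce
    have car: "f \<in> carrier M" "c \<in> carrier M" using fc FM CM by auto
    have "\<pi> (\<ominus>\<^bsub>M\<^esub> c \<oplus>\<^bsub>M\<^esub> f) = \<ominus>\<^bsub>Q\<^esub> \<pi> c \<oplus>\<^bsub>Q\<^esub> \<pi> c"
      using car fc rmod_hom_add[OF \<pi>, of "\<ominus>\<^bsub>M\<^esub> c" f] rmod_hom_neg[OF M Q \<pi>, of c] by simp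
    also have "\<dots> = \<zero>\<^bsub>Q\<^esub>"
      using rmod_hom_closed[OF \<pi> car(2)]
      by (metis Q abelian_group.l_neg right_module.axioms(2))
    finally have "\<ominus>\<^bsub>M\<^esub> c \<oplus>\<^bsub>M\<^esub> f \<in> ?N" using car by simp
    moreover have "f = c \<oplus>\<^bsub>M\<^esub> (\<ominus>\<^bsub>M\<^esub> c \<oplus>\<^bsub>M\<^esub> f)"
      using M.r_neg2[OF car(2,1)] by simp
    ultimately have "f \<in> ?H"
      unfolding set_add_def' using fc(1,2) by blast
    then show "y \<in> \<pi> ` ?H" using fc(3) by blast
  qed
  \<comment> \<open>The kernel of \<open>\<pi>\<close> is contained in \<open>C\<close> plus that
    kernel, so the splittings of \<open>F\<close> and of \<open>?H\<close> along
    \<open>\<pi>\<close> share the kernel term.\<close>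
  moreover have "{x \<in> F. \<pi> x = \<zero>\<^bsub>Q\<^esub>} = {x \<in> ?H. \<pi> x = \<zero>\<^bsub>Q\<^esub>}"
    using FM subset_set_add(2)[OF M C N] by blast
  ultimately have "L (rmod_restrict M F) =
      L (rmod_restrict M ?H) + relative_length L Q (\<pi> ` F) (\<pi> ` C)"
    using L_image[OF M Q \<pi> F] L_image[OF M Q \<pi> H]
      L_split[OF Q rsubmodule_image[OF M Q \<pi> F] rsubmodule_image[OF M Q \<pi> C]]
    by (simp add: add.assoc)
  moreover have "?H \<inter> C = F \<inter> C"
    using subset_set_add(1)[OF M C N] by blast
  ultimately have "L (rmod_restrict M (F \<inter> C)) + relative_length L M F C =
      L (rmod_restrict M (F \<inter> C)) +
      (relative_length L M ?H C + relative_length L Q (\<pi> ` F) (\<pi> ` C))"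
    using L_split[OF M F C] L_split[OF M H C] by (simp add: add.assoc)
  moreover have "L (rmod_restrict M (F \<inter> C)) \<noteq> \<infinity>"
    using fin L_split[OF M F C] by auto
  ultimately show ?thesis
    by (simp add: ennreal_add_left_cancel)
qed

text \<open>Telescoping: \<open>trajectory_Suc\<close> and \<open>L_set_add\<close> give the new
  length as an increment plus the length of the image under \<open>\<phi>\<close>, and injectivity
  makes the latter the old length. The sum starts from zero because the trajectory of length 0 is
  the zero submodule.\<close>

lemma L_trajectory_sum:
  assumes M: "right_module R M" and \<phi>: "\<phi> \<in> rmod_hom R M M" and inj: "inj_on \<phi> (carrier M)"
    and K: "rsubmodule R M K"
  shows "L (rmod_restrict M (trajectory R M \<phi> K n)) =
    (\<Sum>i<n. relative_length L M K (\<phi> ` trajectory R M \<phi> K i))"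
proof (induction n)
  case 0
  have "trajectory R M \<phi> K 0 = {\<zero>\<^bsub>M\<^esub>}"
  proof
    show "trajectory R M \<phi> K 0 \<subseteq> {\<zero>\<^bsub>M\<^esub>}"
      unfolding trajectory_def by (rule rspan_least[OF rsubmodule_zero_set[OF M]]) simp
    show "{\<zero>\<^bsub>M\<^esub>} \<subseteq> trajectory R M \<phi> K 0"
      using rsubmodule_zero[OF M rsubmodule_trajectory[OF M \<phi> rsubmodule_subset[OF M K]]] by simp
  qed
  moreover have "L (rmod_restrict M {\<zero>\<^bsub>M\<^esub>}) = 0"
    by (rule L_zero[OF right_module_restrict[OF M rsubmodule_zero_set[OF M]]]) simp
  ultimately show ?case by simp
next
  case (Suc n)
  note T = rsubmodule_trajectory[OF M \<phi> rsubmodule_subset[OF M K], of n]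
  show ?case
    unfolding trajectory_Suc[OF M \<phi> K] L_set_add[OF M K rsubmodule_image[OF M M \<phi> T]]
      L_inj_image[OF M M \<phi> inj T]
    by (simp add: Suc)
qed

text \<open>The increments \<open>c n\<close> complement the lengths \<open>a n\<close> of
  \<open>K \<inter> C n\<close> to the finite length of \<open>K\<close>. As \<open>a n\<close>
  increases to the length of \<open>K \<inter> D\<close>, the increments tend to the length of
  \<open>K\<close> modulo \<open>D\<close>.\<close>

lemma trajectory_growth_tendsto:
  assumes M: "right_module R M" and \<phi>: "\<phi> \<in> rmod_hom R M M" and inj: "inj_on \<phi> (carrier M)"
    and K: "K \<in> Fin_L R L M"
  shows "(\<lambda>n. L (rmod_restrict M (trajectory R M \<phi> K n)) / of_nat n)
    \<longlonglongrightarrow> relative_length L M K (\<phi> ` full_trajectory R M \<phi> K)"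
proof -
  have KS: "rsubmodule R M K" and fin: "L (rmod_restrict M K) < \<infinity>"
    using K by (auto simp: Fin_L_def)
  note KM = rsubmodule_subset[OF M KS]
  define C where "C n = \<phi> ` trajectory R M \<phi> K n" for n
  define D where "D = \<phi> ` full_trajectory R M \<phi> K"
  have C: "rsubmodule R M (C n)" for n
    unfolding C_def by (rule rsubmodule_image[OF M M \<phi> rsubmodule_trajectory[OF M \<phi> KM]])
  have D: "rsubmodule R M D"
    unfolding D_def by (rule rsubmodule_image[OF M M \<phi> rsubmodule_full_trajectory[OF M \<phi> KM]])
  have DC: "K \<inter> D = (\<Union>n. K \<inter> C n)"
    by (auto simp: C_def D_def full_trajectory_def)
  have inc: "incseq (\<lambda>n. K \<inter> C n)"
    using incseqD[OF incseq_trajectory[OF M \<phi> KM]] unfolding C_def by (intro monoI) blast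
  define a where "a n = L (rmod_restrict M (K \<inter> C n))" for n
  define c where "c n = relative_length L M K (C n)" for n
  have KC: "rsubmodule R M (K \<inter> C n)" for n by (intro rsubmodule_Int M KS C)
  have "incseq a"
    unfolding a_def by (intro monoI L_mono[OF M KC KC] incseqD[OF inc])
  then have "a \<longlonglongrightarrow> (SUP n. a n)" by (rule LIMSEQ_SUP)
  then have a_lim: "a \<longlonglongrightarrow> L (rmod_restrict M (K \<inter> D))"
    unfolding DC L_UN_chain[OF M KC inc] a_def .
  have split: "L (rmod_restrict M K) = a n + c n" for n
    unfolding a_def c_def by (rule L_split[OF M KS C])
  have splitD: "L (rmod_restrict M K) = L (rmod_restrict M (K \<inter> D)) + relative_length L M K D"
    by (rule L_split[OF M KS D])
  have a_fin: "a n < \<infinity>" and c_fin: "c n < \<infinity>" for n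
    using fin split[of n] by (auto simp: less_top[symmetric])
  have D_fin: "L (rmod_restrict M (K \<inter> D)) < \<infinity>" "relative_length L M K D < \<infinity>"
    using fin splitD by (auto simp: less_top[symmetric])
  \<comment> \<open>Real and extended division are compared for positive \<open>n\<close>, which
    suffices for the limit.\<close>
  have eq: "ennreal ((\<Sum>i<n. enn2real (c i)) / real n) =
      L (rmod_restrict M (trajectory R M \<phi> K n)) / of_nat n" if "n > 0" for n
  proof -
    have "L (rmod_restrict M (trajectory R M \<phi> K n)) = (\<Sum>i<n. c i)"
      unfolding c_def C_def by (rule L_trajectory_sum[OF M \<phi> inj KS])
    also have "\<dots> = (\<Sum>i<n. ennreal (enn2real (c i)))"
      using c_fin by simp
    also have "\<dots> = ennreal (\<Sum>i<n. enn2real (c i))"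
      by (rule sum_ennreal) simp
    finally show ?thesis
      using that by (simp add: divide_ennreal[symmetric] sum_nonneg ennreal_of_nat_eq_real_of_nat)
  qed
  \<comment> \<open>All lengths here are finite, so \<open>c n\<close> can be recovered as a
    difference of reals, where subtraction is continuous.\<close>
  have "(\<lambda>n. enn2real (a n)) \<longlonglongrightarrow> enn2real (L (rmod_restrict M (K \<inter> D)))"
    using a_lim a_fin D_fin by (subst tendsto_ennreal_iff[symmetric]) auto
  then have "(\<lambda>n. enn2real (L (rmod_restrict M K)) - enn2real (a n))
      \<longlonglongrightarrow> enn2real (L (rmod_restrict M K)) - enn2real (L (rmod_restrict M (K \<inter> D)))"
    by (intro tendsto_diff tendsto_const)
  moreover have "enn2real (L (rmod_restrict M K)) - enn2real (a n) = enn2real (c n)" for n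
    using a_fin c_fin by (simp add: split[of n] enn2real_add)
  moreover have "enn2real (L (rmod_restrict M K)) - enn2real (L (rmod_restrict M (K \<inter> D)))
      = enn2real (relative_length L M K D)"
    using D_fin by (simp add: splitD enn2real_add)
  ultimately have "(\<lambda>n. (\<Sum>i<n. enn2real (c i)) / real n)
      \<longlonglongrightarrow> enn2real (relative_length L M K D)"
    by (intro Cesaro_mean_tendsto) simp
  then have "(\<lambda>n. ennreal ((\<Sum>i<n. enn2real (c i)) / real n))
      \<longlonglongrightarrow> relative_length L M K D"
    using tendsto_ennrealI D_fin(2) by fastforce
  moreover have "\<forall>\<^sub>F n in sequentially. ennreal ((\<Sum>i<n. enn2real (c i)) / real n) =
      L (rmod_restrict M (trajectory R M \<phi> K n)) / of_nat n"
    using eventually_gt_at_top[of 0] by eventually_elim (rule eq)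
  ultimately show ?thesis
    unfolding D_def[symmetric] by (rule Lim_transform_eventually)
qed

text \<open>\<open>lim\<close> has its intended value only once convergence is known. From here on
  the entropy at \<open>K\<close> can be handled without limits, as a length modulo one fixed
  submodule.\<close>

lemma ent_at_eq:
  assumes "right_module R M" "\<phi> \<in> rmod_hom R M M" "inj_on \<phi> (carrier M)" "K \<in> Fin_L R L M"
  shows "ent_at R L M \<phi> K = relative_length L M K (\<phi> ` full_trajectory R M \<phi> K)"
  unfolding ent_at_def by (rule limI[OF trajectory_growth_tendsto[OF assms]])

lemma ent_at_tendsto:
  assumes "right_module R M" "\<phi> \<in> rmod_hom R M M" "inj_on \<phi> (carrier M)" "K \<in> Fin_L R L M"
  shows "(\<lambda>n. L (rmod_restrict M (trajectory R M \<phi> K n)) / of_nat n) \<longlonglongrightarrow> ent_at R L M \<phi> K"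
  unfolding ent_at_eq[OF assms] by (rule trajectory_growth_tendsto[OF assms])

lemma ent_at_inj_image:
  assumes N: "right_module R N" and M: "right_module R M"
    and \<psi>: "\<psi> \<in> rmod_hom R N N" and \<iota>: "\<iota> \<in> Laurent_hom R N \<psi> M \<phi>"
    and inj: "inj_on \<iota> (carrier N)" and K: "K \<subseteq> carrier N"
  shows "ent_at R L M \<phi> (\<iota> ` K) = ent_at R L N \<psi> K"
proof -
  have "\<iota> \<in> rmod_hom R N M" using \<iota> by (simp add: Laurent_hom_def)
  then show ?thesis
    unfolding ent_at_def image_trajectory[OF N M \<psi> \<iota> K, symmetric]
    by (simp add: L_inj_image[OF N M _ inj rsubmodule_trajectory[OF N \<psi> K]])
qed

lemma rspan_in_Fin_L:
  assumes "right_module R M" "locally_L_finite R L M" "finite S" "S \<subseteq> carrier M"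
  shows "rspan R M S \<in> Fin_L R L M"
  using assms rsubmodule_rspan[OF assms(1,4)]
  by (auto simp: Fin_L_def locally_L_finite_def fg_rsubmodule_def)

text \<open>\<open>A\<close> may have infinite length, so it is approximated by spans of finite
  subsets, which are \<open>L\<close>-finite by local finiteness. The image under
  \<open>\<phi>\<close> of the full trajectory of such a span lies in \<open>C\<close>, and dividing
  by the larger \<open>C\<close> only lowers the length. Both halves of the additivity proof use
  this.\<close>

lemma relative_length_le_ent_at_bound:
  assumes M: "right_module R M" and \<phi>: "\<phi> \<in> rmod_hom R M M" and inj: "inj_on \<phi> (carrier M)"
    and lf: "locally_L_finite R L M"
    and A: "rsubmodule R M A" and C: "rsubmodule R M C"
    and AC: "\<phi> ` full_trajectory R M \<phi> A \<subseteq> C"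
    and bound: "\<And>S. finite S \<Longrightarrow> S \<subseteq> A \<Longrightarrow> ent_at R L M \<phi> (rspan R M S) \<le> b"
  shows "relative_length L M A C \<le> b"
  unfolding relative_length_def
proof (rule L_image_le[OF M right_module_rquotient[OF M C] coset_rep_in_hom[OF M C] A])
  fix S assume S: "finite S" "S \<subseteq> A"
  note AM = rsubmodule_subset[OF M A]
  have G: "rspan R M S \<in> Fin_L R L M"
    using S AM by (intro rspan_in_Fin_L[OF M lf]) auto
  then have GS: "rsubmodule R M (rspan R M S)" and fin: "L (rmod_restrict M (rspan R M S)) < \<infinity>"
    by (auto simp: Fin_L_def)
  note GM = rsubmodule_subset[OF M GS]
  have "rspan R M S \<subseteq> full_trajectory R M \<phi> A"
    using rspan_least[OF A S(2)] subset_full_trajectory by (rule subset_trans)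
  then have "full_trajectory R M \<phi> (rspan R M S) \<subseteq> full_trajectory R M \<phi> A"
    unfolding full_trajectory_def[of R M \<phi> "rspan R M S"]
    by (intro UN_least trajectory_least[OF rsubmodule_full_trajectory[OF M \<phi> AM]
          image_full_trajectory_subset[OF M \<phi> A]])
  then have "\<phi> ` full_trajectory R M \<phi> (rspan R M S) \<subseteq> C"
    using AC by blast
  then have "relative_length L M (rspan R M S) C \<le> ent_at R L M \<phi> (rspan R M S)"
    unfolding ent_at_eq[OF M \<phi> inj G]
    by (intro relative_length_antimono[OF M GS _ C _ fin] rsubmodule_image[OF M M \<phi>]
        rsubmodule_full_trajectory[OF M \<phi> GM])
  also have "\<dots> \<le> b" by (rule bound[OF S])
  finally show "L (rmod_restrict (rquotient M C) (coset_rep M C ` rspan R M S)) \<le> b"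
    unfolding relative_length_def .
qed

section \<open>Additivity of the entropy\<close>

lemma ent_at_le_ent: "K \<in> Fin_L R L M \<Longrightarrow> ent_at R L M \<phi> K \<le> ent R L M \<phi>"
  unfolding ent_def by (rule SUP_upper)

text \<open>The zero submodule is a member. Nonemptiness allows a summand to be moved into a
  supremum.\<close>

lemma Fin_L_nonempty:
  assumes "right_module R P"
  shows "Fin_L R L P \<noteq> {}"
  using L_zero[OF right_module_restrict[OF assms rsubmodule_zero_set[OF assms]]]
    rsubmodule_zero_set[OF assms]
  by (auto simp: Fin_L_def)

context
  fixes N M Q :: "('r, 'm) rmodule" and \<psi> \<phi> \<chi> \<iota> \<pi> :: "'m \<Rightarrow> 'm"
  assumes N: "right_module R N" and M: "right_module R M" and Q: "right_module R Q"
    and \<psi>: "\<psi> \<in> rmod_hom R N N" "inj_on \<psi> (carrier N)"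
    and \<phi>: "\<phi> \<in> rmod_hom R M M" "inj_on \<phi> (carrier M)"
    and \<chi>: "\<chi> \<in> rmod_hom R Q Q" "inj_on \<chi> (carrier Q)"
    and lfN: "locally_L_finite R L N" and lfM: "locally_L_finite R L M"
    and lfQ: "locally_L_finite R L Q"
    and \<iota>: "\<iota> \<in> Laurent_hom R N \<psi> M \<phi>" and \<pi>: "\<pi> \<in> Laurent_hom R M \<phi> Q \<chi>"
    and exact: "rmod_short_exact R N M Q \<iota> \<pi>"
begin

lemma exact_homs: "\<iota> \<in> rmod_hom R N M" "inj_on \<iota> (carrier N)"
    "\<pi> \<in> rmod_hom R M Q" "\<pi> ` carrier M = carrier Q"
  using exact by (simp_all add: rmod_short_exact_def)

lemma ent_at_le_ent_add_ent:
  assumes F: "F \<in> Fin_L R L M"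
  shows "ent_at R L M \<phi> F \<le> ent R L N \<psi> + ent R L Q \<chi>"
proof -
  interpret M: abelian_group M using M by (rule right_module.axioms(2))
  have FS: "rsubmodule R M F" and fin: "L (rmod_restrict M F) < \<infinity>"
    using F by (auto simp: Fin_L_def)
  note FM = rsubmodule_subset[OF M FS]
  define T where "T = full_trajectory R M \<phi> F"
  define C where "C = \<phi> ` T"
  define N' where "N' = \<iota> ` carrier N"
  have T: "rsubmodule R M T"
    unfolding T_def by (rule rsubmodule_full_trajectory[OF M \<phi>(1) FM])
  have C: "rsubmodule R M C"
    unfolding C_def by (rule rsubmodule_image[OF M M \<phi>(1) T])
  have CT: "C \<subseteq> T"
    unfolding C_def T_def by (rule image_full_trajectory_subset[OF M \<phi>(1) FS])
  have FT: "F \<subseteq> T"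
    unfolding T_def by (rule subset_full_trajectory)
  have N': "rsubmodule R M N'"
    unfolding N'_def by (rule rsubmodule_image[OF N M exact_homs(1) rsubmodule_carrier[OF N]])
  have H: "rsubmodule R M (F \<inter> (C <+>\<^bsub>M\<^esub> N'))"
    by (intro rsubmodule_Int rsubmodule_sum M FS C N')
  have TN: "rsubmodule R M (T \<inter> N')"
    by (intro rsubmodule_Int M T N')
  have "ent_at R L M \<phi> F = relative_length L M F C"
    unfolding C_def T_def by (rule ent_at_eq[OF M \<phi> F])
  also have "\<dots> = relative_length L M (F \<inter> (C <+>\<^bsub>M\<^esub> N')) C + relative_length L Q (\<pi> ` F) (\<pi> ` C)"
    using relative_length_exact[OF M Q exact_homs(3) FS C fin] kernel_eq_image[OF exact]
    by (simp add: N'_def)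
  also have "\<dots> \<le> ent R L N \<psi> + ent R L Q \<chi>"
  proof (rule add_mono)
    \<comment> \<open>If \<open>h = c + n\<close>, then \<open>h\<close> and \<open>n\<close> have
      the same class modulo \<open>C\<close>, and \<open>n = - c + h\<close> lies in
      \<open>T\<close> because \<open>C\<close> and \<open>F\<close> do.\<close>
    have "coset_rep M C ` (F \<inter> (C <+>\<^bsub>M\<^esub> N')) \<subseteq> coset_rep M C ` (T \<inter> N')"
    proof
      fix y assume "y \<in> coset_rep M C ` (F \<inter> (C <+>\<^bsub>M\<^esub> N'))"
      then obtain h c n where h: "y = coset_rep M C h" "h \<in> F" "h = c \<oplus>\<^bsub>M\<^esub> n" "c \<in> C" "n \<in> N'"
        unfolding set_add_def' by blast
      have car: "c \<in> carrier M" "n \<in> carrier M"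
        using h rsubmodule_subset[OF M C] rsubmodule_subset[OF M N'] by auto
      have "n = \<ominus>\<^bsub>M\<^esub> c \<oplus>\<^bsub>M\<^esub> h"
        using car h(3) M.r_neg1 by simp
      moreover have "\<ominus>\<^bsub>M\<^esub> c \<oplus>\<^bsub>M\<^esub> h \<in> T"
        using h CT FT by (intro rsubmodule_add[OF M T] rsubmodule_neg[OF M T]) auto
      moreover have "y = coset_rep M C n"
        using h(1,3) car coset_rep_add[OF M C car(2) h(4)] M.a_comm by simp
      ultimately show "y \<in> coset_rep M C ` (T \<inter> N')"
        using h(5) by blast
    qed
    then have "relative_length L M (F \<inter> (C <+>\<^bsub>M\<^esub> N')) C \<le> relative_length L M (T \<inter> N') C"
      by (rule relative_length_mono[OF M H TN C])
    also have "\<dots> \<le> ent R L N \<psi>"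
    proof (rule relative_length_le_ent_at_bound[OF M \<phi> lfM TN C])
      \<comment> \<open>\<open>T\<close> is stable under \<open>\<phi>\<close>, so trajectories
        starting in it stay in it.\<close>
      have "full_trajectory R M \<phi> (T \<inter> N') \<subseteq> T"
        unfolding full_trajectory_def
        using T CT by (intro UN_least trajectory_least) (auto simp: C_def)
      then show "\<phi> ` full_trajectory R M \<phi> (T \<inter> N') \<subseteq> C"
        unfolding C_def by blast
    next
      fix S assume "finite S" "S \<subseteq> T \<inter> N'"
      then have "finite S" "S \<subseteq> \<iota> ` carrier N" by (auto simp: N'_def)
      \<comment> \<open>Generators inside the image of \<open>\<iota>\<close> are lifted to
        \<open>N\<close>, where their span is \<open>L\<close>-finite and has the same entropy under
        \<open>\<psi>\<close>.\<close>
      then obtain S0 where S0: "S0 \<subseteq> carrier N" "finite S0" "S = \<iota> ` S0"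
        using finite_subset_image by metis
      have K: "rspan R N S0 \<in> Fin_L R L N"
        by (rule rspan_in_Fin_L[OF N lfN S0(2,1)])
      then have "rspan R N S0 \<subseteq> carrier N"
        by (simp add: Fin_L_def rsubmodule_subset[OF N])
      then have "ent_at R L M \<phi> (rspan R M S) = ent_at R L N \<psi> (rspan R N S0)"
        unfolding S0(3) image_rspan[OF N M exact_homs(1) S0(1), symmetric]
        by (rule ent_at_inj_image[OF N M \<psi>(1) \<iota> exact_homs(2)])
      then show "ent_at R L M \<phi> (rspan R M S) \<le> ent R L N \<psi>"
        using ent_at_le_ent[OF K] by simp
    qed
    finally show "relative_length L M (F \<inter> (C <+>\<^bsub>M\<^esub> N')) C \<le> ent R L N \<psi>" .
  next
    have \<pi>F: "\<pi> ` F \<in> Fin_L R L Q"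
      using rsubmodule_image[OF M Q exact_homs(3) FS] L_image[OF M Q exact_homs(3) FS] fin
      by (auto simp: Fin_L_def less_top[symmetric])
    \<comment> \<open>\<open>\<pi>\<close> carries the trajectories of \<open>F\<close> to those of
      its image, so the image of \<open>C\<close> is exactly the submodule that
      \<open>ent_at_eq\<close> divides out for \<open>\<chi>\<close>.\<close>
    have "\<pi> ` T = full_trajectory R Q \<chi> (\<pi> ` F)"
      unfolding T_def full_trajectory_def image_UN image_trajectory[OF M Q \<phi>(1) \<pi> FM] ..
    moreover have "\<pi> ` C = \<chi> ` \<pi> ` T"
      using \<pi> rsubmodule_subset[OF M T]
      by (auto simp: C_def Laurent_hom_def image_image subset_iff intro!: image_cong)
    ultimately have "relative_length L Q (\<pi> ` F) (\<pi> ` C) = ent_at R L Q \<chi> (\<pi> ` F)"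
      by (simp add: ent_at_eq[OF Q \<chi> \<pi>F])
    then show "relative_length L Q (\<pi> ` F) (\<pi> ` C) \<le> ent R L Q \<chi>"
      using ent_at_le_ent[OF \<pi>F] by simp
  qed
  finally show ?thesis .
qed

text \<open>A finite generating set lifts along \<open>\<pi>\<close>, and by local finiteness the
  span of the lift is again \<open>L\<close>-finite. Each trajectory of \<open>G\<close> contains
  the image of that of \<open>F\<close> inside the kernel of \<open>\<pi>\<close> and maps onto a
  submodule containing that of the span, so the inequality holds for every \<open>n\<close> and
  passes to the limit.\<close>

lemma ent_at_add_ent_at_rspan_le:
  assumes F: "F \<in> Fin_L R L N" and S: "finite S" "S \<subseteq> carrier Q"
  shows "ent_at R L N \<psi> F + ent_at R L Q \<chi> (rspan R Q S) \<le> ent R L M \<phi>"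
proof -
  have FS: "rsubmodule R N F" and fin: "L (rmod_restrict N F) < \<infinity>"
    using F by (auto simp: Fin_L_def)
  note FN = rsubmodule_subset[OF N FS]
  obtain S0 where S0: "S0 \<subseteq> carrier M" "finite S0" "S = \<pi> ` S0"
    using S finite_subset_image exact_homs(4) by metis
  define G where "G = \<iota> ` F <+>\<^bsub>M\<^esub> rspan R M S0"
  have \<iota>F: "rsubmodule R M (\<iota> ` F)"
    by (rule rsubmodule_image[OF N M exact_homs(1) FS])
  have G0: "rspan R M S0 \<in> Fin_L R L M"
    by (rule rspan_in_Fin_L[OF M lfM S0(2,1)])
  then have G0S: "rsubmodule R M (rspan R M S0)" by (simp add: Fin_L_def)
  have GS: "rsubmodule R M G"
    unfolding G_def by (rule rsubmodule_sum[OF M \<iota>F G0S])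
  note GM = rsubmodule_subset[OF M GS]
  \<comment> \<open>Adding the copy of \<open>F\<close> to the lifted span adds at most the length
    of \<open>F\<close>, so \<open>G\<close> remains \<open>L\<close>-finite.\<close>
  have "relative_length L M (\<iota> ` F) (rspan R M S0) < \<infinity>"
    using relative_length_le[OF M \<iota>F G0S] L_inj_image[OF N M exact_homs(1,2) FS] fin by simp
  then have G: "G \<in> Fin_L R L M"
    using GS G0 L_set_add[OF M \<iota>F G0S] by (auto simp: Fin_L_def G_def)
  have K: "rspan R Q S \<in> Fin_L R L Q"
    by (rule rspan_in_Fin_L[OF Q lfQ S])
  have "L (rmod_restrict N (trajectory R N \<psi> F n)) + L (rmod_restrict Q (trajectory R Q \<chi> (rspan R Q S) n))
      \<le> L (rmod_restrict M (trajectory R M \<phi> G n))" for n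
  proof -
    let ?T = "trajectory R M \<phi> G n"
    have T: "rsubmodule R M ?T" by (rule rsubmodule_trajectory[OF M \<phi>(1) GM])
    have ker: "rsubmodule R M {x \<in> ?T. \<pi> x = \<zero>\<^bsub>Q\<^esub>}"
      using rsubmodule_preimage[OF M Q exact_homs(3) T rsubmodule_zero_set[OF Q]] by simp
    have TN: "rsubmodule R N (trajectory R N \<psi> F n)"
      by (rule rsubmodule_trajectory[OF N \<psi>(1) FN])
    have mono: "trajectory R M \<phi> A n \<subseteq> ?T" if "A \<subseteq> G" for A
      unfolding trajectory_def
      using that by (intro rspan_mono[OF M] orbit_subset_carrier[OF M \<phi>(1) GM]) fast
    have "\<iota> ` trajectory R N \<psi> F n = trajectory R M \<phi> (\<iota> ` F) n"
      by (rule image_trajectory[OF N M \<psi>(1) \<iota> FN])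
    also have "\<dots> \<subseteq> ?T"
      unfolding G_def[symmetric] by (rule mono) (simp add: G_def subset_set_add(1)[OF M \<iota>F G0S])
    finally have "\<iota> ` trajectory R N \<psi> F n \<subseteq> {x \<in> ?T. \<pi> x = \<zero>\<^bsub>Q\<^esub>}"
      using kernel_eq_image[OF exact] rsubmodule_subset[OF N TN] by blast
    then have "L (rmod_restrict N (trajectory R N \<psi> F n)) \<le> L (rmod_restrict M {x \<in> ?T. \<pi> x = \<zero>\<^bsub>Q\<^esub>})"
      unfolding L_inj_image[OF N M exact_homs(1,2) TN, symmetric]
      by (intro L_mono[OF M _ ker] rsubmodule_image[OF N M exact_homs(1) TN])
    moreover have "trajectory R Q \<chi> (rspan R Q S) n = \<pi> ` trajectory R M \<phi> (rspan R M S0) n"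
      unfolding S0(3) image_rspan[OF M Q exact_homs(3) S0(1), symmetric]
      by (rule image_trajectory[OF M Q \<phi>(1) \<pi> rsubmodule_subset[OF M G0S], symmetric])
    then have "trajectory R Q \<chi> (rspan R Q S) n \<subseteq> \<pi> ` ?T"
      using mono[of "rspan R M S0"] subset_set_add(2)[OF M \<iota>F G0S] by (auto simp: G_def)
    then have "L (rmod_restrict Q (trajectory R Q \<chi> (rspan R Q S) n)) \<le> L (rmod_restrict Q (\<pi> ` ?T))"
      using K by (intro L_mono[OF Q] rsubmodule_image[OF M Q exact_homs(3) T]
          rsubmodule_trajectory[OF Q \<chi>(1)] rsubmodule_subset[OF Q]) (auto simp: Fin_L_def)
    ultimately show ?thesis
      unfolding L_image[OF M Q exact_homs(3) T] by (rule add_mono)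
  qed
  then have "L (rmod_restrict N (trajectory R N \<psi> F n)) / of_nat n +
      L (rmod_restrict Q (trajectory R Q \<chi> (rspan R Q S) n)) / of_nat n
      \<le> L (rmod_restrict M (trajectory R M \<phi> G n)) / of_nat n" for n
    unfolding add_divide_distrib_ennreal[symmetric] by (rule divide_right_mono_ennreal)
  then have "ent_at R L N \<psi> F + ent_at R L Q \<chi> (rspan R Q S) \<le> ent_at R L M \<phi> G"
    by (intro LIMSEQ_le[OF tendsto_add[OF ent_at_tendsto[OF N \<psi> F] ent_at_tendsto[OF Q \<chi> K]]
          ent_at_tendsto[OF M \<phi> G]]) auto
  then show ?thesis
    using ent_at_le_ent[OF G] by (rule order_trans)
qed

text \<open>An arbitrary \<open>L\<close>-finite \<open>K\<close> is reached from its finitely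
  generated submodules by \<open>relative_length_le_ent_at_bound\<close>, once the entropy in
  \<open>N\<close> has been moved to the right-hand side.\<close>

lemma ent_at_add_ent_at_le:
  assumes F: "F \<in> Fin_L R L N" and K: "K \<in> Fin_L R L Q"
  shows "ent_at R L N \<psi> F + ent_at R L Q \<chi> K \<le> ent R L M \<phi>"
proof (cases "ent R L M \<phi> = \<infinity>")
  case False
  define e where "e = ent_at R L N \<psi> F"
  have KS: "rsubmodule R Q K"
    using K by (auto simp: Fin_L_def)
  note KQ = rsubmodule_subset[OF Q KS]
  \<comment> \<open>The empty generating set already shows that \<open>e\<close> is bounded by the
    entropy of \<open>\<phi>\<close>. This makes \<open>e\<close> finite and lets the truncated
    subtraction below be undone.\<close>
  have "e \<le> e + ent_at R L Q \<chi> (rspan R Q {})" by simp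
  also have "\<dots> \<le> ent R L M \<phi>"
    unfolding e_def by (rule ent_at_add_ent_at_rspan_le[OF F]) simp_all
  finally have le: "e \<le> ent R L M \<phi>" .
  then have fin: "e \<noteq> \<infinity>" using False by (auto simp: top_unique)
  have "ent_at R L Q \<chi> K \<le> ent R L M \<phi> - e"
    unfolding ent_at_eq[OF Q \<chi> K]
  proof (rule relative_length_le_ent_at_bound[OF Q \<chi> lfQ KS _ subset_refl])
    show "rsubmodule R Q (\<chi> ` full_trajectory R Q \<chi> K)"
      by (rule rsubmodule_image[OF Q Q \<chi>(1) rsubmodule_full_trajectory[OF Q \<chi>(1) KQ]])
    fix S assume "finite S" "S \<subseteq> K"
    then have "e + ent_at R L Q \<chi> (rspan R Q S) \<le> ent R L M \<phi>"
      using ent_at_add_ent_at_rspan_le[OF F, of S] KQ by (auto simp: e_def)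
    then have "e + ent_at R L Q \<chi> (rspan R Q S) - e \<le> ent R L M \<phi> - e"
      by (rule ennreal_minus_mono) simp
    then show "ent_at R L Q \<chi> (rspan R Q S) \<le> ent R L M \<phi> - e"
      using fin by simp
  qed
  then have "ent_at R L Q \<chi> K + e \<le> ent R L M \<phi> - e + e"
    by (rule add_right_mono)
  also have "\<dots> = ent R L M \<phi>"
    by (rule diff_add_cancel_ennreal[OF le])
  finally show ?thesis
    by (simp only: e_def add.commute)
qed simp

text \<open>For the lower bound, \<open>F\<close> and \<open>K\<close> range independently over
  nonempty families, so the sum of the two suprema is an iterated supremum of sums.\<close>

lemma ent_additive: "ent R L M \<phi> = ent R L N \<psi> + ent R L Q \<chi>"
proof (rule antisym)
  show "ent R L M \<phi> \<le> ent R L N \<psi> + ent R L Q \<chi>"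
    unfolding ent_def[of R L M] by (rule SUP_least) (rule ent_at_le_ent_add_ent)
  have "(SUP F\<in>Fin_L R L N. ent_at R L N \<psi> F + (SUP K\<in>Fin_L R L Q. ent_at R L Q \<chi> K))
      \<le> ent R L M \<phi>"
    unfolding ennreal_SUP_add_right[OF Fin_L_nonempty[OF Q]]
    by (intro SUP_least ent_at_add_ent_at_le)
  then show "ent R L N \<psi> + ent R L Q \<chi> \<le> ent R L M \<phi>"
    unfolding ent_def[of R L N] ent_def[of R L Q]
    by (simp add: ennreal_SUP_add_left[OF Fin_L_nonempty[OF N]])
qed

end

end

theorem theorem5p3:
  fixes R :: "('r, 'z) ring_scheme"
    and L :: "('r, 'm) rmodule \<Rightarrow> ennreal"
    and N M Q :: "('r, 'm) rmodule"
    and \<psi> \<phi> \<chi> \<iota> \<pi> :: "'m \<Rightarrow> 'm"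
  assumes "ring R"
    and "length_function R L"
    and "lFin_Laurent R L N \<psi>"
    and "lFin_Laurent R L M \<phi>"
    and "lFin_Laurent R L Q \<chi>"
    and "\<iota> \<in> Laurent_hom R N \<psi> M \<phi>"
    and "\<pi> \<in> Laurent_hom R M \<phi> Q \<chi>"
    and "rmod_short_exact R N M Q \<iota> \<pi>"
  shows "ent R L M \<phi> = ent R L N \<psi> + ent R L Q \<chi>"
proof -
  interpret length_function R L by fact
  show ?thesis
    using assms(3-5)
    by (intro ent_additive[OF _ _ _ _ _ _ _ _ _ _ _ _ assms(6-8)])
      (auto simp: lFin_Laurent_def rmod_iso_def bij_betw_def)
qed

end
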